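(* Let $I\subseteq\overline d=\{1,\dots,d\}$ and let $\mathbf X\sim \mathrm{DPP}_B(K)$, where the kernel $K$ can be written as $$K(x,y)=K_I(x_I,y_I)\,K_{I^c}(x_{I^c},y_{I^c}),\qquad x,y\in B,$$ with $K_I:B_I\times B_I\to\mathbb C$ and $K_{I^c}:B_{I^c}\times B_{I^c}\to\mathbb C$ two continuous covariance functions. Then the $k$th order intensity function ($k\ge 1$) of the projected point process $\mathbf X_I$ is given, for pairwise distinct $x^{(1)},\dots,x^{(k)}\in B_I$, by $$\rho_{\mathbf X_I}^{(k)}\left(x^{(1)},\ldots,x^{(k)}\right)=\sum_{\sigma\in S_k}(-1)^{k-C(\sigma)}\left[\prod_{i=1}^k K_I\left(x^{(i)},x^{(\sigma(i))}\right)\right]\mathrm{tr}_{B_{I^c}}(K_{I^c})^{k-c(\sigma)}\prod_{\varepsilon\in\mathcal S(\sigma)}\mathrm{tr}_{B_{I^c}}\left(K_{I^c}^{(c(\varepsilon))}\right).$$ In particular, the intensity of $\mathbf X_I$ is given by $\rho_{\mathbf X_I}(x)=K_I(x,x)\,\mathrm{tr}_{B_{I^c}}(K_{I^c})$, and its pair correlation function is given by $$g_{\mathbf X_I}(x,y)=1-\frac{\mathrm{tr}_{B_{I^c}}\left(K_{I^c}^{(2)}\right)}{\mathrm{tr}_{B_{I^c}}(K_{I^c})^2}\left(1-g_{\mathbf Y^{(I)}}(x,y)\right)$$ for any pairwise distinct $x,y\in B_I$, where $\mathbf Y^{(I)}\sim\mathrm{DPP}_{B_I}(K_I)$.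
   Context: Setting: $B=B_1\times\dots\times B_d\subset\mathbb R^d$ is compact. For $I\subseteq\overline d=\{1,\dots,d\}$, $\iota=|I|$, $I^c=\overline d\setminus I$, $B_I=\prod_{i\in I}B_i$, $P_I:\mathbb R^d\to\mathbb R^\iota$ is the orthogonal projection keeping the coordinates indexed by $I$, and $x_I=P_Ix$. If $I^c=\emptyset$, then $K_{I^c}$, its iterates and their traces are taken to be $1$. A point process $\mathbf X$ on $B$ is a random locally finite subset of $B$ (simple: no multiple points). Its $k$th order intensity function $\rho^{(k)}_{\mathbf X}:B^k\to[0,\infty)$ is characterized by: for every nonnegative measurable $h:B^k\to[0,\infty)$, $$\mathbb E\Big[\sum^{\ne}_{x^{(1)},\dots,x^{(k)}\in\mathbf X}h(x^{(1)},\dots,x^{(k)})\Big]=\int_{B^k}\rho^{(k)}_{\mathbf X}(x^{(1)},\dots,x^{(k)})h(x^{(1)},\dots,x^{(k)})\,dx^{(1)}\cdots dx^{(k)},$$ where the sum is over $k$-tuples of pairwise distinct points. By convention $\rho^{(k)}_{\mathbf X}(x^{(1)},\dots,x^{(k)})=0$ if $x^{(i)}=x^{(j)}$ for some $i\ne j$. $\rho_{\mathbf X}=\rho_{\mathbf X}^{(1)}$ is the intensity. The pair correlation function is $g_{\mathbf X}(x,y)=\rho^{(2)}_{\mathbf X}(x,y)/(\rho_{\mathbf X}(x)\rho_{\mathbf X}(y))$ for distinct $x,y$, and $g_{\mathbf X}(x,y)$ is set to $0$ if $\rho_{\mathbf X}(x)$ or $\rho_{\mathbf X}(y)$ is zero.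 The same definitions apply to processes on $B_I$. The projected process is $\mathbf X_I=P_I\mathbf X$, i.e. the collection of the points $x_I$, $x\in\mathbf X$, on $B_I$. A covariance function is a Hermitian positive semidefinite function. For a continuous covariance function $K:B\times B\to\mathbb C$, $\mathbf X\sim\mathrm{DPP}_B(K)$ (determinantal point process on $B$ with kernel $K$) means that for all $k\ge1$, $\rho^{(k)}_{\mathbf X}(x^{(1)},\dots,x^{(k)})=\det[K(x^{(i)},x^{(j)})]_{i,j=1}^k$; $\mathrm{DPP}_{B_I}(K_I)$ is defined in the same way on $B_I$. The trace is $\mathrm{tr}_B(K)=\int_BK(x,x)\,dx$, and kernels are assumed to have finite trace. The iterated kernels are $K^{(1)}=K$ and $K^{(m)}(x,y)=\int K^{(m-1)}(x,z)K(z,y)\,dz$ for $m>1$, the integral being over the domain on which the kernel is defined. $S_k$ is the symmetric group on $\{1,\dots,k\}$. For $\sigma\in S_k$, $c(\sigma)$ is the size of the support $\{i:\sigma(i)\ne i\}$, $\mathcal S(\sigma)$ is the set of disjoint cycles of $\sigma$ with non-empty support, and $C(\sigma)$ is the number of disjoint cycles of $\sigma$ including those with empty support, i.e. fixed points (so for a cycle $\varepsilon\in\mathcal S(\sigma)$, $c(\varepsilon)$ is its length).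
   Formalization: The pair correlation formula is stated only for distinct x, y at which the intensity of the projected process is nonzero; where it vanishes, both pair correlations are 0 by convention and the formula as written fails in general or divides by zero. *)

theory Defs
  imports
    "HOL-Probability.Probability"
    "HOL-Library.Multiset"
    "HOL-Combinatorics.Permutations"
    "HOL-Combinatorics.Orbits"
    "Jordan_Normal_Form.Determinant"
begin

(* A point of R^J, for a finite set J of coordinates, is an extensional function on J; thus
   B_J = PiE J B, the projection P_I is (%x. restrict x I), and the topology of R^J is the one
   induced by the product topology on nat => real. *)

type_synonym point = "nat \<Rightarrow> real"

(* Lebesgue measure on B_J. For J = {} the space is a single point of mass 1, so that a kernel
   equal to 1 on B_{} has trace 1 and all its iterates equal to 1: this is the usual convention
   for the empty set of coordinates. *)

definition leb_box :: "nat set \<Rightarrow> (nat \<Rightarrow> real set) \<Rightarrow> point measure" where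
  "leb_box J B = restrict_space (PiM J (\<lambda>_. lborel)) (PiE J B)"

(* k-tuples of points are extensional functions on {..<k}, i.e. indexed from 0. *)

definition leb_tuples :: "nat set \<Rightarrow> (nat \<Rightarrow> real set) \<Rightarrow> nat \<Rightarrow> (nat \<Rightarrow> point) measure" where
  "leb_tuples J B k = PiM {..<k} (\<lambda>_. leb_box J B)"

definition tuple :: "'a list \<Rightarrow> nat \<Rightarrow> 'a" where
  "tuple xs = (\<lambda>i\<in>{..<length xs}. xs ! i)"

(* B is compact throughout, so locally finite collections of points of B are finite. Multisets are
   used because projecting a collection of points may produce multiple points. *)

definition point_process ::
    "'w measure \<Rightarrow> nat set \<Rightarrow> (nat \<Rightarrow> real set) \<Rightarrow> ('w \<Rightarrow> point multiset) \<Rightarrow> bool" where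
  "point_process M J B X \<longleftrightarrow>
     prob_space M \<and>
     (\<forall>\<omega>\<in>space M. set_mset (X \<omega>) \<subseteq> PiE J B) \<and>
     (\<forall>A\<in>sets (leb_box J B).
        (\<lambda>\<omega>. size (filter_mset (\<lambda>x. x \<in> A) (X \<omega>))) \<in> measurable M (count_space UNIV))"

definition simple_process :: "'w measure \<Rightarrow> ('w \<Rightarrow> point multiset) \<Rightarrow> bool" where
  "simple_process M X \<longleftrightarrow> (\<forall>\<omega>\<in>space M. \<forall>x. count (X \<omega>) x \<le> 1)"

definition project :: "nat set \<Rightarrow> ('w \<Rightarrow> point multiset) \<Rightarrow> 'w \<Rightarrow> point multiset" where
  "project I X \<omega> = image_mset (\<lambda>x. restrict x I) (X \<omega>)"

(* The sum over k-tuples of points with pairwise distinct locations; the product of the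
   multiplicities is 1 when the collection is simple. *)

definition distinct_sum :: "point multiset \<Rightarrow> nat \<Rightarrow> ((nat \<Rightarrow> point) \<Rightarrow> real) \<Rightarrow> ennreal" where
  "distinct_sum X k h =
     (\<Sum>x | x \<in> ({..<k} \<rightarrow>\<^sub>E set_mset X) \<and> inj_on x {..<k}.
        of_nat (\<Prod>i<k. count X (x i)) * ennreal (h x))"

(* The defining property determines an intensity function almost everywhere only, hence a
   predicate: rho is a version of the k-th order intensity function of X. *)

definition intensity_function ::
    "'w measure \<Rightarrow> nat set \<Rightarrow> (nat \<Rightarrow> real set) \<Rightarrow> ('w \<Rightarrow> point multiset) \<Rightarrow> nat
       \<Rightarrow> ((nat \<Rightarrow> point) \<Rightarrow> real) \<Rightarrow> bool" where
  "intensity_function M J B X k \<rho> \<longleftrightarrow>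
     \<rho> \<in> borel_measurable (leb_tuples J B k) \<and>
     (\<forall>x\<in>space (leb_tuples J B k). 0 \<le> \<rho> x) \<and>
     (\<forall>x\<in>space (leb_tuples J B k). \<not> inj_on x {..<k} \<longrightarrow> \<rho> x = 0) \<and>
     (\<forall>h\<in>borel_measurable (leb_tuples J B k). (\<forall>x\<in>space (leb_tuples J B k). 0 \<le> h x) \<longrightarrow>
        (\<integral>\<^sup>+\<omega>. distinct_sum (X \<omega>) k h \<partial>M) =
        (\<integral>\<^sup>+x. ennreal (\<rho> x * h x) \<partial>leb_tuples J B k))"

(* rho k stands for the k-th order intensity function; the value is meant for x \<noteq> y. *)

definition pair_correlation ::
    "(nat \<Rightarrow> (nat \<Rightarrow> point) \<Rightarrow> real) \<Rightarrow> point \<Rightarrow> point \<Rightarrow> real" where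
  "pair_correlation \<rho> x y =
     (if \<rho> 1 (tuple [x]) = 0 \<or> \<rho> 1 (tuple [y]) = 0 then 0
      else \<rho> 2 (tuple [x, y]) / (\<rho> 1 (tuple [x]) * \<rho> 1 (tuple [y])))"

(* The quadratic form is real because K is Hermitian, so taking Re loses nothing. *)

definition covariance_on :: "point set \<Rightarrow> (point \<Rightarrow> point \<Rightarrow> complex) \<Rightarrow> bool" where
  "covariance_on S K \<longleftrightarrow>
     (\<forall>x\<in>S. \<forall>y\<in>S. K y x = cnj (K x y)) \<and>
     (\<forall>F c. finite F \<and> F \<subseteq> S \<longrightarrow>
        0 \<le> Re (\<Sum>x\<in>F. \<Sum>y\<in>F. c x * cnj (c y) * K x y))"

definition continuous_covariance :: "point set \<Rightarrow> (point \<Rightarrow> point \<Rightarrow> complex) \<Rightarrow> bool" where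
  "continuous_covariance S K \<longleftrightarrow>
     covariance_on S K \<and> continuous_on (S \<times> S) (\<lambda>(x, y). K x y)"

definition kernel_trace ::
    "nat set \<Rightarrow> (nat \<Rightarrow> real set) \<Rightarrow> (point \<Rightarrow> point \<Rightarrow> complex) \<Rightarrow> complex" where
  "kernel_trace J B K = (\<integral>x. K x x \<partial>leb_box J B)"

(* Iterates are indexed from 1; nothing is specified for 0. *)

fun iterated_kernel ::
    "nat set \<Rightarrow> (nat \<Rightarrow> real set) \<Rightarrow> (point \<Rightarrow> point \<Rightarrow> complex) \<Rightarrow> nat
       \<Rightarrow> point \<Rightarrow> point \<Rightarrow> complex" where
  "iterated_kernel J B K 0 = undefined"
| "iterated_kernel J B K (Suc 0) = K"
| "iterated_kernel J B K (Suc (Suc m)) =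
     (\<lambda>x y. \<integral>z. iterated_kernel J B K (Suc m) x z * K z y \<partial>leb_box J B)"

(* X ~ DPP_{B_J}(K), where rho k is the version of the k-th order intensity function that is
   given by the determinant everywhere. *)

definition DPP_with ::
    "'w measure \<Rightarrow> nat set \<Rightarrow> (nat \<Rightarrow> real set) \<Rightarrow> ('w \<Rightarrow> point multiset)
       \<Rightarrow> (point \<Rightarrow> point \<Rightarrow> complex) \<Rightarrow> (nat \<Rightarrow> (nat \<Rightarrow> point) \<Rightarrow> real) \<Rightarrow> bool" where
  "DPP_with M J B X K \<rho> \<longleftrightarrow>
     continuous_covariance (PiE J B) K \<and>
     point_process M J B X \<and> simple_process M X \<and>
     (\<forall>k\<ge>1. intensity_function M J B X k (\<rho> k) \<and>
        (\<forall>x \<in> {..<k} \<rightarrow>\<^sub>E PiE J B.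
           complex_of_real (\<rho> k x) = Determinant.det (mat k k (\<lambda>(i, j). K (x i) (x j)))))"

definition DPP ::
    "'w measure \<Rightarrow> nat set \<Rightarrow> (nat \<Rightarrow> real set) \<Rightarrow> ('w \<Rightarrow> point multiset)
       \<Rightarrow> (point \<Rightarrow> point \<Rightarrow> complex) \<Rightarrow> bool" where
  "DPP M J B X K \<longleftrightarrow> (\<exists>\<rho>. DPP_with M J B X K \<rho>)"

definition supp_size :: "(nat \<Rightarrow> nat) \<Rightarrow> nat" where
  "supp_size \<sigma> = card {i. \<sigma> i \<noteq> i}"

(* The cycle of sigma through i, as a permutation, is perm_restrict sigma (orbit sigma i). *)

definition nontrivial_cycles :: "(nat \<Rightarrow> nat) \<Rightarrow> (nat \<Rightarrow> nat) set" where
  "nontrivial_cycles \<sigma> = {perm_restrict \<sigma> (orbit \<sigma> i) |i. \<sigma> i \<noteq> i}"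

(* Fixed points count as (distinct) cycles of empty support, so orbits are counted here. *)

definition num_cycles :: "nat \<Rightarrow> (nat \<Rightarrow> nat) \<Rightarrow> nat" where
  "num_cycles k \<sigma> = card (orbit \<sigma> ` {..<k})"

end

theory Submission
  imports Defs
begin

text \<open>
  The intensities of the projection are marginals of the intensities of \<open>X\<close>. Summing a function \<open>h\<close> over
  the \<open>k\<close>-tuples of distinct points of the projected configuration amounts to summing
  \<open>h\<close> of the projected tuple over those \<open>k\<close>-tuples of points of \<open>X\<close> whose projections do not collide
  (\<open>distinct_sum_image_mset\<close>). By the defining property of the intensities of \<open>X\<close> and Fubini
  (\<open>distr_merge_leb_box\<close>, \<open>distr_pair_PiM\<close>), the expectation is the integral of \<open>h\<close> against
  \<open>\<integral> det [KI (x i) (x j) * KIc (z i) (z j)] dz\<close>, taken over the tuples \<open>z\<close> of complementary coordinates.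
  This function is nonnegative at every tuple because the determinant is an intensity of \<open>X\<close>.

  The Leibniz expansion turns it into a sum over permutations \<open>\<sigma>\<close> of the products
  \<open>\<Prod>i<k. KI (x i) (x (\<sigma> i))\<close> times the integrals of \<open>\<Prod>i<k. KIc (z i) (z (\<sigma> i))\<close>. Along a cycle of \<open>\<sigma>\<close> of
  length \<open>n\<close> each variable occurs as the second argument of one factor and the first argument of the next;
  integrating out all variables but one composes the kernel with itself, and the last
  integration gives the trace of the \<open>n\<close>-th iterate (\<open>integral_cycles\<close>). Removing the points of a cycle
  one at a time also shows that the sign of \<open>\<sigma>\<close> is \<open>(-1)\<close> to the power of \<open>k\<close> minus the number of cycles
  (\<open>sign_eq_orbits\<close>), so that the same induction on permutations yields both.

  The formulas for the intensity and for the pair correlation are the cases \<open>k = 1\<close> and \<open>k = 2\<close>; the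
  latter is compared with the \<open>2 \<times> 2\<close> determinant of \<open>KI\<close>.
\<close>

section \<open>Shortening the cycles of a permutation\<close>

text \<open>When \<open>b\<close> is not fixed, its cycle \<open>\<dots> \<rightarrow> a \<rightarrow> b \<rightarrow> \<sigma> b \<rightarrow> \<dots>\<close> becomes
  \<open>\<dots> \<rightarrow> a \<rightarrow> \<sigma> b \<rightarrow> \<dots>\<close>, \<open>b\<close> becomes a fixed point, and the other cycles are untouched.\<close>

definition bypass :: "('a \<Rightarrow> 'a) \<Rightarrow> 'a \<Rightarrow> 'a \<Rightarrow> 'a" where
  "bypass \<sigma> b = Transposition.transpose b (\<sigma> b) \<circ> \<sigma>"

lemma bypass_apply:
  assumes "inj \<sigma>"
  shows "bypass \<sigma> b x = (if x = b then b else if \<sigma> x = b then \<sigma> b else \<sigma> x)"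
  using injD[OF assms, of x b] by (auto simp: bypass_def Transposition.transpose_def)

lemma bypass_permutes:
  assumes "\<sigma> permutes insert b A"
  shows "bypass \<sigma> b permutes A"
  unfolding bypass_def using permutes_insert_lemma[OF assms] .

lemma orbit_bypass:
  assumes inj: "inj \<sigma>" and b: "\<sigma> b \<noteq> b" and x: "x \<noteq> b"
  shows "orbit (bypass \<sigma> b) x = orbit \<sigma> x - {b}"
proof (intro equalityI subsetI)
  fix y assume "y \<in> orbit (bypass \<sigma> b) x"
  then show "y \<in> orbit \<sigma> x - {b}"
  proof induction
    case base
    have "\<sigma> b \<in> orbit \<sigma> x" if "\<sigma> x = b"
      using orbit.step[OF orbit.base, of \<sigma> x] that by simp
    then show ?case using x b by (simp add: bypass_apply[OF inj] orbit.base)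
  next
    case (step y)
    then have "y \<in> orbit \<sigma> x" "y \<noteq> b" by auto
    moreover have "\<sigma> b \<in> orbit \<sigma> x" if "\<sigma> y = b"
      using orbit.step[OF orbit.step[OF \<open>y \<in> orbit \<sigma> x\<close>]] that by simp
    ultimately show ?case using b by (simp add: bypass_apply[OF inj] orbit.step)
  qed
next
  \<comment> \<open>An orbit of \<open>\<sigma>\<close> that reaches \<open>b\<close> goes on to \<open>\<sigma> b\<close>, which the shortened cycle reaches directly.\<close>
  have "(y \<noteq> b \<longrightarrow> y \<in> orbit (bypass \<sigma> b) x) \<and> (y = b \<longrightarrow> \<sigma> b \<in> orbit (bypass \<sigma> b) x)"
    if "y \<in> orbit \<sigma> x" for y
    using that
  proof induction
    case base
    show ?case
      using orbit.base[of "bypass \<sigma> b" x] x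
      by (auto simp: bypass_apply[OF inj, of b x] split: if_splits)
  next
    case (step y)
    show ?case
    proof (cases "y = b")
      case True
      then show ?thesis using step.IH b by auto
    next
      case False
      then have "bypass \<sigma> b y \<in> orbit (bypass \<sigma> b) x"
        using step.IH by (auto intro: orbit.step)
      then show ?thesis using False by (auto simp: bypass_apply[OF inj, of b y] split: if_splits)
    qed
  qed
  then show "y \<in> orbit (bypass \<sigma> b) x" if "y \<in> orbit \<sigma> x - {b}" for y
    using that by auto
qed

lemma orbit_apply_mem_iff:
  assumes "finite A" "\<sigma> permutes A" 
  shows "\<sigma> y \<in> orbit \<sigma> x \<longleftrightarrow> y \<in> orbit \<sigma> x"
proof
  have p: "permutation \<sigma>" using assms by (auto simp: permutation_permutes)
  show "y \<in> orbit \<sigma> x" if "\<sigma> y \<in> orbit \<sigma> x"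
    using that
  proof cases
    case base
    then have "y = x" using injD[OF permutes_inj[OF assms(2)]] by blast
    then show ?thesis using permutation_self_in_orbit[OF p] by simp
  next
    case (step z)
    then have "y = z" using injD[OF permutes_inj[OF assms(2)]] by blast
    then show ?thesis using step by simp
  qed
qed (rule orbit.step)

text \<open>Bypassing a point that is not fixed keeps the number of cycles: a cycle of the new permutation
  on \<open>A\<close> is turned back into one of \<open>\<sigma>\<close> by putting \<open>b\<close> next to its predecessor \<open>a\<close>. The
  map \<open>f\<close> is what later reindexes products over cycles.\<close>

lemma orbits_bypass:
  assumes fin: "finite A" and bA: "b \<notin> A" and p: "\<sigma> permutes insert b A"
    and b: "\<sigma> b \<noteq> b" and ab: "\<sigma> a = b"
  defines "f \<equiv> \<lambda>Q. if a \<in> Q then insert b Q else Q"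
  shows "orbit \<sigma> ` insert b A = f ` (orbit (bypass \<sigma> b) ` A)"
    and "inj_on f (orbit (bypass \<sigma> b) ` A)"
    and "\<And>Q. Q \<in> orbit (bypass \<sigma> b) ` A \<Longrightarrow> Q \<subseteq> A"
proof -
  have inj: "inj \<sigma>" using p by (rule permutes_inj)
  have perm: "permutation \<sigma>" using p fin by (auto simp: permutation_permutes)
  have ne: "a \<noteq> b" using b ab by auto
  have cA: "\<sigma> b \<in> A"
    using b permutes_in_image[OF p, of b] by auto
  have f: "f (orbit (bypass \<sigma> b) x) = orbit \<sigma> x" if "x \<in> A" for x
  proof -
    have "x \<noteq> b" using that bA by auto
    moreover have "a \<in> orbit \<sigma> x \<longleftrightarrow> b \<in> orbit \<sigma> x"
      using orbit_apply_mem_iff[OF _ p, of a x] fin ab by auto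
    ultimately show ?thesis using ne by (auto simp: f_def orbit_bypass[OF inj b])
  qed
  have "orbit \<sigma> b = orbit \<sigma> (\<sigma> b)"
    by (simp add: permutation_orbit_step[OF perm])
  then have "orbit \<sigma> ` insert b A = orbit \<sigma> ` A" using cA by auto
  also have "\<dots> = f ` (orbit (bypass \<sigma> b) ` A)"
    unfolding image_image using f by auto
  finally show "orbit \<sigma> ` insert b A = f ` (orbit (bypass \<sigma> b) ` A)" .
  have q: "bypass \<sigma> b permutes A" using p by (rule bypass_permutes)
  show sub: "Q \<subseteq> A" if "Q \<in> orbit (bypass \<sigma> b) ` A" for Q
    using that permutes_orbit_subset[OF q] by auto
  show "inj_on f (orbit (bypass \<sigma> b) ` A)"
  proof (rule inj_onI)
    fix P Q assume "P \<in> orbit (bypass \<sigma> b) ` A" "Q \<in> orbit (bypass \<sigma> b) ` A" "f P = f Q"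
    moreover from this have "b \<notin> P" "b \<notin> Q" using sub bA by blast+
    ultimately show "P = Q" unfolding f_def by (metis insertI1 insert_ident)
  qed
qed

lemma orbits_of_fixed:
  assumes "\<And>i. i \<in> A \<Longrightarrow> \<sigma> i = i"
  shows "orbit \<sigma> ` A = (\<lambda>i. {i}) ` A"
  using assms orbit_eq_singleton_iff[of \<sigma>] by (intro image_cong) auto

text \<open>Induction that shortens a cycle by one point until only fixed points remain. It suits both the
  sign, which changes at each step, and the integral of a product along the cycles, in which
  bypassing \<open>b\<close> means integrating out the variable at \<open>b\<close>.\<close>

lemma permutes_bypass_induct [consumes 2, case_names fixed bypass]:
  assumes "finite A" and "\<sigma> permutes A"
    and fixed: "\<And>A \<sigma>. finite A \<Longrightarrow> (\<And>i. i \<in> A \<Longrightarrow> \<sigma> i = i) \<Longrightarrow> \<sigma> permutes A \<Longrightarrow> P A \<sigma>"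
    and bypass: "\<And>A \<sigma> a b. finite A \<Longrightarrow> b \<notin> A \<Longrightarrow> \<sigma> permutes insert b A \<Longrightarrow>
       \<sigma> b \<noteq> b \<Longrightarrow> \<sigma> a = b \<Longrightarrow> a \<in> A \<Longrightarrow> \<sigma> b \<in> A \<Longrightarrow> P A (bypass \<sigma> b) \<Longrightarrow> P (insert b A) \<sigma>"
  shows "P A \<sigma>"
  using assms(1,2)
proof (induction A arbitrary: \<sigma> rule: finite_psubset_induct)
  case (psubset A)
  show ?case
  proof (cases "\<forall>i\<in>A. \<sigma> i = i")
    case True
    then show ?thesis using psubset by (intro fixed) auto
  next
    case False
    then obtain b where b: "b \<in> A" "\<sigma> b \<noteq> b" by auto
    define A' where "A' = A - {b}"
    have A: "A = insert b A'" using b by (auto simp: A'_def)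
    have p: "\<sigma> permutes insert b A'" using psubset.prems A by simp
    obtain a where a: "\<sigma> a = b" using permutes_surj[OF p] by (metis surjD)
    have "a \<in> insert b A'" using permutes_in_image[OF p, of a] a by auto
    then have aA: "a \<in> A'" using b a by auto
    have cA: "\<sigma> b \<in> A'" using permutes_in_image[OF p, of b] b by auto
    have "P A' (bypass \<sigma> b)"
      using b bypass_permutes[OF p] by (intro psubset.IH) (auto simp: A'_def)
    then show ?thesis
      unfolding A using p psubset.hyps a aA cA b by (intro bypass[of A' b \<sigma> a]) (auto simp: A'_def)
  qed
qed

lemma card_orbits_le: "finite A \<Longrightarrow> card (orbit \<sigma> ` A) \<le> card A"
  by (rule card_image_le)

text \<open>Each bypass multiplies by one transposition and removes one point, while the number of cycles
  stays the same; for the identity there are as many cycles as points.\<close>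

lemma sign_eq_orbits:
  assumes "finite A" "\<sigma> permutes A"
  shows "sign \<sigma> = (-1) ^ (card A - card (orbit \<sigma> ` A))"
  using assms
proof (induction rule: permutes_bypass_induct)
  case (fixed A \<sigma>)
  then have "\<sigma> i = i" for i using permutes_not_in[of \<sigma> A i] by blast
  then have "\<sigma> = id" by (simp add: fun_eq_iff)
  moreover have "card (orbit \<sigma> ` A) = card A"
    by (simp add: orbits_of_fixed fixed card_image)
  ultimately show ?case by (simp only: sign_id diff_self_eq_0 power_0)
next
  case (bypass A \<sigma> a b)
  have perm: "permutation \<sigma>" using bypass by (auto simp: permutation_permutes)
  have "card (orbit \<sigma> ` insert b A) = card (orbit (bypass \<sigma> b) ` A)"
    using orbits_bypass(1,2)[OF bypass(1-5)] by (simp only: card_image)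
  moreover have "sign (bypass \<sigma> b) = - sign \<sigma>"
    using bypass(4) by (simp add: bypass_def sign_compose perm permutation_swap_id sign_swap_id)
  moreover have "card (orbit (bypass \<sigma> b) ` A) \<le> card A" using bypass by (simp add: card_orbits_le)
  ultimately show ?case using bypass by (simp add: Suc_diff_le)
qed

text \<open>A product over all cycles, fixed points included, is split into the two factors that occur in
  the theorem: the singletons contribute equal factors, and the other orbits correspond to the
  cycles with non-empty support.\<close>

lemma prod_orbits_nontrivial_cycles:
  fixes \<tau> :: "nat \<Rightarrow> 'a::comm_monoid_mult"
  assumes fin: "finite A" and p: "\<sigma> permutes A"
  shows "(\<Prod>Q\<in>orbit \<sigma> ` A. \<tau> (card Q)) =
     \<tau> 1 ^ (card A - supp_size \<sigma>) * (\<Prod>\<epsilon>\<in>nontrivial_cycles \<sigma>. \<tau> (supp_size \<epsilon>))"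
proof -
  define F where "F = {i \<in> A. \<sigma> i = i}"
  define G where "G = {i. \<sigma> i \<noteq> i}"
  have A: "A = F \<union> G" "F \<inter> G = {}"
    using permutes_not_in[OF p] by (auto simp: F_def G_def)
  have finFG: "finite F" "finite G" using A fin by auto
  have perm: "permutation \<sigma>" using p fin by (auto simp: permutation_permutes)
  have self: "i \<in> orbit \<sigma> i" for i by (rule permutation_self_in_orbit[OF perm])
  have orbG: "orbit \<sigma> i \<subseteq> G" if "i \<in> G" for i
  proof
    fix y assume "y \<in> orbit \<sigma> i"
    then show "y \<in> G"
      by induction (use that permutes_inj[OF p] in \<open>auto simp: G_def inj_eq\<close>)
  qed
  have orbF: "orbit \<sigma> ` F = (\<lambda>i. {i}) ` F" by (rule orbits_of_fixed) (auto simp: F_def)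
  have disj: "orbit \<sigma> ` F \<inter> orbit \<sigma> ` G = {}"
    unfolding orbF using orbG self A(2) by blast
  have cardF: "card F = card A - supp_size \<sigma>"
    using A finFG by (simp add: supp_size_def card_Un_disjoint G_def)
  have nc: "nontrivial_cycles \<sigma> = perm_restrict \<sigma> ` orbit \<sigma> ` G"
    by (auto simp: nontrivial_cycles_def G_def)
  have supp: "{j. perm_restrict \<sigma> Q j \<noteq> j} = Q" if "Q \<in> orbit \<sigma> ` G" for Q
    using that orbG by (auto simp: perm_restrict_def G_def)
  have inj: "inj_on (perm_restrict \<sigma>) (orbit \<sigma> ` G)"
    by (rule inj_onI) (metis supp)
  have "(\<Prod>\<epsilon>\<in>nontrivial_cycles \<sigma>. \<tau> (supp_size \<epsilon>)) = (\<Prod>Q\<in>orbit \<sigma> ` G. \<tau> (card Q))"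
    unfolding nc by (subst prod.reindex[OF inj]) (auto intro!: prod.cong simp: supp_size_def supp)
  moreover have "(\<Prod>Q\<in>orbit \<sigma> ` F. \<tau> (card Q)) = \<tau> 1 ^ card F"
    unfolding orbF by (subst prod.reindex) auto
  ultimately show ?thesis
    using disj finFG by (simp add: A(1) image_Un prod.union_disjoint cardF[unfolded A(1)])
qed

section \<open>Iterated kernels and integrals along cycles\<close>

text \<open>What is needed of a continuous kernel on a compact box: products of its values at the points
  of a tuple are integrable over tuples, and its iterates inherit measurability and boundedness.\<close>

locale bounded_kernel =
  fixes J :: "nat set" and B :: "nat \<Rightarrow> real set" and K :: "point \<Rightarrow> point \<Rightarrow> complex"
    and C :: real
  assumes fin_box: "finite_measure (leb_box J B)"
    and K_meas: "(\<lambda>(x, y). K x y) \<in> borel_measurable (leb_box J B \<Otimes>\<^sub>M leb_box J B)"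
    and K_bound: "\<And>x y. x \<in> space (leb_box J B) \<Longrightarrow> y \<in> space (leb_box J B) \<Longrightarrow> norm (K x y) \<le> C"
begin

abbreviation "N \<equiv> leb_box J B"
abbreviation "Kit \<equiv> iterated_kernel J B K"

sublocale N: finite_measure N by (rule fin_box)
sublocale NN: pair_sigma_finite N N ..
sublocale PN: product_sigma_finite "\<lambda>_::nat. N" ..

lemma iterated_Suc:
  assumes "1 \<le> m"
  shows "Kit (Suc m) = (\<lambda>x y. \<integral>z. Kit m x z * K z y \<partial>N)"
  using assms by (cases m) auto

lemma iterated_measurable:
  assumes "1 \<le> m"
  shows "(\<lambda>(x, y). Kit m x y) \<in> borel_measurable (N \<Otimes>\<^sub>M N)"
  using assms
proof (induction m rule: dec_induct)
  case base
  then show ?case using K_meas by simp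
next
  case (step m)
  note [measurable] = step.IH K_meas
  have "(\<lambda>p. \<integral>z. Kit m (fst p) z * K z (snd p) \<partial>N) \<in> borel_measurable (N \<Otimes>\<^sub>M N)"
    by (intro N.borel_measurable_lebesgue_integral) measurable
  then show ?case using step.hyps by (simp add: iterated_Suc case_prod_beta')
qed

lemma iterated_bound:
  assumes "1 \<le> m"
  shows "\<exists>C'. \<forall>x\<in>space N. \<forall>y\<in>space N. norm (Kit m x y) \<le> C'"
  using assms
proof (induction m rule: dec_induct)
  case base
  then show ?case using K_bound by auto
next
  case (step m)
  then obtain C' where C': "\<And>x y. x \<in> space N \<Longrightarrow> y \<in> space N \<Longrightarrow> norm (Kit m x y) \<le> C'"
    by blast
  note [measurable] = iterated_measurable[OF step.hyps(1)] K_meas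
  have "norm (Kit (Suc m) x y) \<le> (\<integral>z. C' * C \<partial>N)" if xy: "x \<in> space N" "y \<in> space N" for x y
  proof -
    have le: "norm (Kit m x z * K z y) \<le> C' * C" if "z \<in> space N" for z
      unfolding norm_mult using C' K_bound xy that
      by (intro mult_mono) (auto intro: order.trans[OF norm_ge_zero])
    have "integrable N (\<lambda>z. Kit m x z * K z y)"
      using le xy by (intro N.integrable_const_bound[where B="C' * C"]) auto
    then show ?thesis
      unfolding iterated_Suc[OF step.hyps(1)] using le
      by (intro order.trans[OF integral_norm_bound] integral_mono) (auto intro: N.integrable_const)
  qed
  then show ?case by blast
qed

text \<open>The iterates compose like powers of an integral operator; the definition gives the case
  \<open>n = 1\<close>, and Fubini moves one factor across.\<close>

lemma iterated_add:
  assumes m: "1 \<le> m" and n: "1 \<le> n" and x: "x \<in> space N" and y: "y \<in> space N"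
  shows "(\<integral>z. Kit m x z * Kit n z y \<partial>N) = Kit (m + n) x y"
  using n y
proof (induction n arbitrary: y rule: dec_induct)
  case base
  then show ?case using m by (simp add: iterated_Suc)
next
  case (step n)
  note [measurable] = iterated_measurable[OF step.hyps(1)] iterated_measurable[OF m] K_meas
  note y = step.prems
  obtain Cm where Cm: "\<And>x y. x \<in> space N \<Longrightarrow> y \<in> space N \<Longrightarrow> norm (Kit m x y) \<le> Cm"
    using iterated_bound[OF m] by blast
  obtain Cn where Cn: "\<And>x y. x \<in> space N \<Longrightarrow> y \<in> space N \<Longrightarrow> norm (Kit n x y) \<le> Cn"
    using iterated_bound[OF step.hyps(1)] by blast
  interpret NxN: finite_measure "N \<Otimes>\<^sub>M N"
    by (intro finite_measure_pair_measure N.finite_measure_axioms)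
  have le: "norm (Kit m x z * Kit n z w * K w y) \<le> Cm * Cn * C"
    if "z \<in> space N" "w \<in> space N" for z w
    unfolding norm_mult
    using Cm[OF x that(1)] Cn[OF that] K_bound[OF that(2) y]
      order.trans[OF norm_ge_zero Cm[OF x x]] order.trans[OF norm_ge_zero Cn[OF x x]]
    by (intro mult_mono mult_nonneg_nonneg) auto
  have int: "integrable (N \<Otimes>\<^sub>M N) (\<lambda>(z, w). Kit m x z * Kit n z w * K w y)"
    using le x y
    by (intro NxN.integrable_const_bound[where B="Cm * Cn * C"]) (auto simp: space_pair_measure)
  have "(\<integral>z. Kit m x z * Kit (Suc n) z y \<partial>N) = (\<integral>z. (\<integral>w. Kit m x z * Kit n z w * K w y \<partial>N) \<partial>N)"
    by (simp add: iterated_Suc[OF step.hyps(1)] mult.assoc)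
  also have "\<dots> = (\<integral>w. (\<integral>z. Kit m x z * Kit n z w * K w y \<partial>N) \<partial>N)"
    by (rule NN.Fubini_integral[OF int, symmetric])
  also have "\<dots> = (\<integral>w. Kit (m + n) x w * K w y \<partial>N)"
    using step.IH by (intro Bochner_Integration.integral_cong) auto
  also have "\<dots> = Kit (m + Suc n) x y"
    using m by (simp add: iterated_Suc)
  finally show ?case .
qed

lemma finite_measure_PiM: "finite (A :: nat set) \<Longrightarrow> finite_measure (Pi\<^sub>M A (\<lambda>_. N))"
  using PN.emeasure_PiM[of A "\<lambda>_. space N"]
  by (intro finite_measureI) (simp add: space_PiM power_eq_top_ennreal)

lemma integrable_product:
  fixes A :: "nat set"
  assumes fin: "finite A" and \<sigma>: "\<And>i. i \<in> A \<Longrightarrow> \<sigma> i \<in> A" and m: "\<And>i. i \<in> A \<Longrightarrow> 1 \<le> m i"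
  shows "integrable (Pi\<^sub>M A (\<lambda>_. N)) (\<lambda>z. \<Prod>i\<in>A. Kit (m i) (z i) (z (\<sigma> i)))"
proof -
  interpret finite_measure "Pi\<^sub>M A (\<lambda>_. N)" by (rule finite_measure_PiM[OF fin])
  have "\<forall>i\<in>A. \<exists>C'. \<forall>x\<in>space N. \<forall>y\<in>space N. norm (Kit (m i) x y) \<le> C'"
    using iterated_bound m by blast
  then obtain C' where C': "\<And>i x y. i \<in> A \<Longrightarrow> x \<in> space N \<Longrightarrow> y \<in> space N \<Longrightarrow> norm (Kit (m i) x y) \<le> C' i"
    by metis
  show ?thesis
  proof (rule integrable_const_bound)
    show "AE z in Pi\<^sub>M A (\<lambda>_. N). norm (\<Prod>i\<in>A. Kit (m i) (z i) (z (\<sigma> i))) \<le> (\<Prod>i\<in>A. C' i)"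
      using C' \<sigma> by (intro AE_I2) (auto simp: prod_norm[symmetric] space_PiM PiE_iff intro!: prod_mono)
    have "(\<lambda>z. Kit (m i) (z i) (z (\<sigma> i))) \<in> borel_measurable (Pi\<^sub>M A (\<lambda>_. N))" if "i \<in> A" for i
      using that \<sigma> m
      by (intro measurable_Pair_compose_split[OF iterated_measurable] measurable_component_singleton) auto
    then show "(\<lambda>z. \<Prod>i\<in>A. Kit (m i) (z i) (z (\<sigma> i))) \<in> borel_measurable (Pi\<^sub>M A (\<lambda>_. N))"
      by (intro borel_measurable_prod) auto
  qed
qed

text \<open>The edge from \<open>i\<close> to \<open>\<sigma> i\<close> carries the iterate of order \<open>m i\<close>. The orders are arbitrary so that the
  induction goes through: integrating out the variable at \<open>b\<close> merges the edges
  \<open>a \<rightarrow> b \<rightarrow> \<sigma> b\<close> into one edge \<open>a \<rightarrow> \<sigma> b\<close> whose order is the sum of the two, and the total order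
  around each cycle does not change. At the end every cycle is a loop, whose integral is a trace.
  The case of interest is \<open>m i = 1\<close>, where the total order around a cycle is its length.\<close>

lemma integral_cycles:
  fixes A :: "nat set"
  assumes "finite A" "\<sigma> permutes A" and "\<And>i. i \<in> A \<Longrightarrow> 1 \<le> m i"
  shows "(\<integral>z. (\<Prod>i\<in>A. Kit (m i) (z i) (z (\<sigma> i))) \<partial>Pi\<^sub>M A (\<lambda>_. N)) =
    (\<Prod>Q\<in>orbit \<sigma> ` A. kernel_trace J B (Kit (\<Sum>i\<in>Q. m i)))"
  using assms
proof (induction arbitrary: m rule: permutes_bypass_induct)
  case (fixed A \<sigma>)
  have int: "integrable N (\<lambda>x. Kit (m i) x x)" if i: "i \<in> A" for i
  proof -
    note [measurable] = iterated_measurable[OF fixed.prems[OF i]]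
    obtain C' where "\<And>x y. x \<in> space N \<Longrightarrow> y \<in> space N \<Longrightarrow> norm (Kit (m i) x y) \<le> C'"
      using iterated_bound[OF fixed.prems[OF i]] by blast
    then show ?thesis by (intro N.integrable_const_bound[where B=C']) auto
  qed
  have "(\<integral>z. (\<Prod>i\<in>A. Kit (m i) (z i) (z (\<sigma> i))) \<partial>Pi\<^sub>M A (\<lambda>_. N)) =
        (\<integral>z. (\<Prod>i\<in>A. (\<lambda>x. Kit (m i) x x) (z i)) \<partial>Pi\<^sub>M A (\<lambda>_. N))"
    by (intro Bochner_Integration.integral_cong prod.cong refl) (simp add: fixed(2))
  also have "\<dots> = (\<Prod>i\<in>A. kernel_trace J B (Kit (m i)))"
    unfolding kernel_trace_def
    by (rule PN.product_integral_prod[where f = "\<lambda>i x. Kit (m i) x x", OF fixed(1) int])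
  also have "\<dots> = (\<Prod>Q\<in>orbit \<sigma> ` A. kernel_trace J B (Kit (\<Sum>i\<in>Q. m i)))"
    by (simp add: orbits_of_fixed[OF fixed(2)] prod.reindex)
  finally show ?case .
next
  case (bypass A \<sigma> a b)
  note finA = bypass.hyps(1) and bA = bypass.hyps(2) and p = bypass.hyps(3)
    and ab = bypass.hyps(5) and aA = bypass.hyps(6) and cA = bypass.hyps(7)
  define m' where "m' = m(a := m a + m b)"
  define c where "c = \<sigma> b"
  define R where "R z = (\<Prod>i\<in>A - {a}. Kit (m i) (z i) (z (\<sigma> i)))" for z
  have inj: "inj \<sigma>" using p by (rule permutes_inj)
  have ne: "a \<noteq> b" "c \<noteq> b" using aA bA cA by (auto simp: c_def)
  have out: "\<sigma> i \<noteq> b" if "i \<in> A - {a}" for i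
    using injD[OF inj, of i a] that ab by auto
  \<comment> \<open>Only the two edges at \<open>b\<close> involve the variable at \<open>b\<close>; the remaining factors \<open>R z\<close> come out.\<close>
  have inner: "(\<integral>y. (\<Prod>i\<in>insert b A. Kit (m i) ((z(b := y)) i) ((z(b := y)) (\<sigma> i))) \<partial>N) =
      (\<Prod>i\<in>A. Kit (m' i) (z i) (z (bypass \<sigma> b i)))" if z: "z \<in> space (Pi\<^sub>M A (\<lambda>_. N))" for z
  proof -
    have zs: "z a \<in> space N" "z c \<in> space N" using z aA cA by (auto simp: space_PiM c_def)
    have R: "(\<Prod>i\<in>A - {a}. Kit (m i) ((z(b := y)) i) ((z(b := y)) (\<sigma> i))) = R z" for y
      unfolding R_def by (intro prod.cong refl) (use out bA in auto)
    have "(\<integral>y. (\<Prod>i\<in>insert b A. Kit (m i) ((z(b := y)) i) ((z(b := y)) (\<sigma> i))) \<partial>N) =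
       (\<integral>y. (Kit (m a) (z a) y * Kit (m b) y (z c)) * R z \<partial>N)"
      using ne by (simp add: finA bA prod.remove[OF finA aA] R ab c_def[symmetric] mult_ac
        del: fun_upd_apply) (simp add: mult_ac)
    also have "\<dots> = Kit (m a + m b) (z a) (z c) * R z"
      using bypass.prems aA by (simp add: iterated_add zs)
    also have "R z = (\<Prod>i\<in>A - {a}. Kit (m' i) (z i) (z (bypass \<sigma> b i)))"
      unfolding R_def by (intro prod.cong refl) (use out bA in \<open>auto simp: m'_def bypass_apply[OF inj]\<close>)
    also have "Kit (m a + m b) (z a) (z c) * \<dots> = (\<Prod>i\<in>A. Kit (m' i) (z i) (z (bypass \<sigma> b i)))"
      using ne by (simp add: prod.remove[OF finA aA] m'_def bypass_apply[OF inj] ab c_def)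
    finally show ?thesis .
  qed
  have "integrable (Pi\<^sub>M (insert b A) (\<lambda>_. N)) (\<lambda>z. \<Prod>i\<in>insert b A. Kit (m i) (z i) (z (\<sigma> i)))"
    using finA by (intro integrable_product bypass.prems) (simp_all only: permutes_in_image[OF p] finite_insert)
  from PN.product_integral_insert[OF finA bA this]
  have "(\<integral>z. (\<Prod>i\<in>insert b A. Kit (m i) (z i) (z (\<sigma> i))) \<partial>Pi\<^sub>M (insert b A) (\<lambda>_. N)) =
        (\<integral>z. (\<integral>y. (\<Prod>i\<in>insert b A. Kit (m i) ((z(b := y)) i) ((z(b := y)) (\<sigma> i))) \<partial>N) \<partial>Pi\<^sub>M A (\<lambda>_. N))" .
  also have "\<dots> = (\<integral>z. (\<Prod>i\<in>A. Kit (m' i) (z i) (z (bypass \<sigma> b i))) \<partial>Pi\<^sub>M A (\<lambda>_. N))"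
    by (rule Bochner_Integration.integral_cong[OF refl inner])
  also have "\<dots> = (\<Prod>Q\<in>orbit (bypass \<sigma> b) ` A. kernel_trace J B (Kit (\<Sum>i\<in>Q. m' i)))"
    using bypass.prems aA by (intro bypass.IH) (simp add: m'_def trans_le_add1)
  also have "\<dots> = (\<Prod>Q\<in>orbit \<sigma> ` insert b A. kernel_trace J B (Kit (\<Sum>i\<in>Q. m i)))"
  proof -
    have "(\<Sum>i\<in>Q. m' i) = (\<Sum>i\<in>(if a \<in> Q then insert b Q else Q). m i)"
      if "Q \<in> orbit (bypass \<sigma> b) ` A" for Q
    proof (cases "a \<in> Q")
      case True
      have "Q \<subseteq> A" using orbits_bypass(3)[OF bypass.hyps(1-5) that] .
      then have "finite Q" "b \<notin> Q" using finA bA finite_subset by auto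
      moreover have "(\<Sum>i\<in>Q - {a}. m' i) = (\<Sum>i\<in>Q - {a}. m i)"
        by (intro sum.cong) (auto simp: m'_def)
      ultimately show ?thesis
        using True by (simp add: sum.remove[of Q a] m'_def)
    next
      case False
      then show ?thesis by (auto simp: m'_def intro!: sum.cong)
    qed
    then show ?thesis
      unfolding orbits_bypass(1)[OF bypass.hyps(1-5)]
      by (subst prod.reindex[OF orbits_bypass(2)[OF bypass.hyps(1-5)]]) auto
  qed
  finally show ?case .
qed

end

section \<open>Lebesgue measure on boxes and on tuples\<close>

lemma box_in_sets_PiM:
  assumes "finite J" and "\<And>i. i \<in> J \<Longrightarrow> compact (B i)"
  shows "PiE J B \<in> sets (Pi\<^sub>M J (\<lambda>_. lborel :: real measure))"
  using assms by (intro sets_PiM_I_finite) (auto intro: borel_compact)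

lemma space_leb_box: "space (leb_box J B) = PiE J B"
  by (auto simp: leb_box_def space_restrict_space space_PiM)

lemma space_leb_tuples: "space (leb_tuples J B k) = {..<k} \<rightarrow>\<^sub>E PiE J B"
  by (simp add: leb_tuples_def space_PiM space_leb_box)

lemma finite_measure_leb_box:
  assumes "finite J" and "\<And>i. i \<in> J \<Longrightarrow> compact (B i)"
  shows "finite_measure (leb_box J B)"
proof
  interpret L: product_sigma_finite "\<lambda>_::nat. lborel :: real measure" ..
  have "emeasure (Pi\<^sub>M J (\<lambda>_. lborel)) (PiE J B) = (\<Prod>i\<in>J. emeasure lborel (B i))"
    using assms by (intro L.emeasure_PiM) (auto intro: borel_compact)
  also have "\<dots> \<noteq> \<infinity>"
    using assms emeasure_compact_finite by (auto simp: ennreal_prod_eq_top less_top)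
  finally show "emeasure (leb_box J B) (space (leb_box J B)) \<noteq> \<infinity>"
    using box_in_sets_PiM[OF assms]
    by (simp add: space_leb_box) (simp add: leb_box_def emeasure_restrict_space)
qed

lemma leb_box_id_measurable: "(\<lambda>x. x) \<in> measurable (leb_box J B) (Pi\<^sub>M J (\<lambda>_. lborel))"
  unfolding leb_box_def by (intro measurable_restrict_space1 measurable_ident_sets refl)

text \<open>Continuity of a kernel refers to the topology of \<^typ>\<open>nat \<Rightarrow> real\<close>, measurability to the product
  \<open>\<sigma>\<close>-algebra over \<open>J\<close>. They fit because the coordinates outside \<open>J\<close> are constant.\<close>

lemma leb_box_to_borel: "(\<lambda>x. x) \<in> borel_measurable (leb_box J B)"
proof (rule measurable_coordinatewise_then_product)
  fix i
  show "(\<lambda>x. x i) \<in> borel_measurable (leb_box J B)"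
  proof (cases "i \<in> J")
    case True
    have "(\<lambda>x. x i) \<in> measurable (leb_box J B) lborel"
      by (rule measurable_compose[OF leb_box_id_measurable measurable_component_singleton[OF True]])
    then show ?thesis by simp
  next
    case False
    then have "x i = undefined" if "x \<in> space (leb_box J B)" for x
      using that by (auto simp: space_leb_box)
    then show ?thesis by (subst measurable_cong[where g="\<lambda>_. undefined"]) auto
  qed
qed

text \<open>Tychonoff, the coordinates outside \<open>J\<close> ranging over a single point.\<close>

lemma compact_box:
  assumes "\<And>i. i \<in> J \<Longrightarrow> compact (B i)"
  shows "compact (PiE J B :: point set)"
proof -
  have eq: "PiE J B = PiE UNIV (\<lambda>i. if i \<in> J then B i else {undefined})"
    by (auto simp: PiE_iff extensional_def split: if_splits)
  show ?thesis
    unfolding eq compactin_euclidean_iff[symmetric] euclidean_product_topology[symmetric]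
    using assms by (simp add: compactin_PiE)
qed

lemma bounded_kernel_continuous:
  assumes "finite J" and cpt: "\<And>i. i \<in> J \<Longrightarrow> compact (B i)"
    and cov: "continuous_covariance (PiE J B) K"
  shows "\<exists>C. bounded_kernel J B K C"
proof -
  let ?S = "PiE J B" and ?N = "leb_box J B"
  have cont: "continuous_on (?S \<times> ?S) (\<lambda>(x, y). K x y)"
    using cov by (simp add: continuous_covariance_def)
  have "compact ((\<lambda>(x, y). K x y) ` (?S \<times> ?S))"
    using cont compact_box[OF cpt] by (intro compact_continuous_image compact_Times)
  then obtain C where C: "\<forall>x\<in>?S. \<forall>y\<in>?S. norm (K x y) \<le> C"
    by (auto dest!: compact_imp_bounded simp: bounded_iff)
  have "(\<lambda>p. (fst p, snd p)) \<in> measurable (?N \<Otimes>\<^sub>M ?N) (borel \<Otimes>\<^sub>M borel)"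
    by (intro measurable_Pair measurable_compose[OF measurable_fst leb_box_to_borel]
        measurable_compose[OF measurable_snd leb_box_to_borel])
  then have "(\<lambda>p. p) \<in> measurable (?N \<Otimes>\<^sub>M ?N) (restrict_space borel (?S \<times> ?S))"
    by (intro measurable_restrict_space2) (auto simp: space_pair_measure space_leb_box borel_prod)
  from measurable_compose[OF this borel_measurable_continuous_on_restrict[OF cont]]
  have "(\<lambda>(x, y). K x y) \<in> borel_measurable (?N \<Otimes>\<^sub>M ?N)" .
  then have "bounded_kernel J B K C"
    using C finite_measure_leb_box[OF assms(1,2)]
    by (intro bounded_kernel.intro) (auto simp: space_leb_box)
  then show ?thesis ..
qed

lemma restrict_measurable_leb_box:
  assumes "I \<subseteq> J"
  shows "(\<lambda>x. restrict x I) \<in> measurable (leb_box J B) (leb_box I B)"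
  unfolding leb_box_def[of I]
proof (rule measurable_restrict_space2)
  show "(\<lambda>x. restrict x I) \<in> space (leb_box J B) \<rightarrow> PiE I B"
    using assms by (auto simp: space_leb_box PiE_iff)
  show "(\<lambda>x. restrict x I) \<in> measurable (leb_box J B) (Pi\<^sub>M I (\<lambda>_. lborel))"
    by (rule measurable_compose[OF leb_box_id_measurable measurable_restrict_subset[OF assms]])
qed

text \<open>Lebesgue measure on \<open>\<Prod>\<^sub>i B\<^sub>i\<close> is the product of those on two complementary faces. Over
  all of space this is the product structure of Lebesgue measure; restricting to the box only
  multiplies the integrand by the indicators of the two faces.\<close>

lemma distr_merge_leb_box:
  assumes fin: "finite I" "finite J" and disj: "I \<inter> J = {}"
    and cpt: "\<And>i. i \<in> I \<union> J \<Longrightarrow> compact (B i)"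
  shows "merge I J \<in> measurable (leb_box I B \<Otimes>\<^sub>M leb_box J B) (leb_box (I \<union> J) B)"
    and "distr (leb_box I B \<Otimes>\<^sub>M leb_box J B) (leb_box (I \<union> J) B) (merge I J) = leb_box (I \<union> J) B"
proof -
  let ?P = "leb_box I B \<Otimes>\<^sub>M leb_box J B" and ?L = "\<lambda>_::nat. lborel :: real measure"
  interpret L: product_sigma_finite ?L ..
  interpret NI: finite_measure "leb_box I B" using fin cpt by (intro finite_measure_leb_box) auto
  interpret NJ: finite_measure "leb_box J B" using fin cpt by (intro finite_measure_leb_box) auto
  have IB: "PiE I B \<in> sets (Pi\<^sub>M I ?L)" and JB: "PiE J B \<in> sets (Pi\<^sub>M J ?L)"
    and UB: "PiE (I \<union> J) B \<in> sets (Pi\<^sub>M (I \<union> J) ?L)"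
    using fin cpt by (auto intro!: box_in_sets_PiM)
  have "(\<lambda>p. (fst p, snd p)) \<in> measurable ?P (Pi\<^sub>M I ?L \<Otimes>\<^sub>M Pi\<^sub>M J ?L)"
    by (intro measurable_Pair measurable_compose[OF measurable_fst leb_box_id_measurable]
        measurable_compose[OF measurable_snd leb_box_id_measurable])
  from measurable_compose[OF this measurable_merge]
  have m: "merge I J \<in> measurable ?P (Pi\<^sub>M (I \<union> J) ?L)" by simp
  have "merge I J \<in> space ?P \<rightarrow> PiE (I \<union> J) B"
    using disj by (auto simp: space_pair_measure space_leb_box merge_def PiE_iff extensional_def)
  with m show mm: "merge I J \<in> measurable ?P (leb_box (I \<union> J) B)"
    unfolding leb_box_def[of "I \<union> J"] by (intro measurable_restrict_space2)
  show "distr ?P (leb_box (I \<union> J) B) (merge I J) = leb_box (I \<union> J) B"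
  proof (rule measure_eqI)
    fix A assume "A \<in> sets (distr ?P (leb_box (I \<union> J) B) (merge I J))"
    then have A: "A \<in> sets (leb_box (I \<union> J) B)" by simp
    then have AS: "A \<subseteq> PiE (I \<union> J) B" and A': "A \<in> sets (Pi\<^sub>M (I \<union> J) ?L)"
      using UB by (auto simp: leb_box_def sets_restrict_space_iff)
    have "emeasure (leb_box (I \<union> J) B) A = emeasure (Pi\<^sub>M (I \<union> J) ?L) A"
      unfolding leb_box_def using AS UB by (intro emeasure_restrict_space) auto
    also have "\<dots> = (\<integral>\<^sup>+x. indicator A x \<partial>Pi\<^sub>M (I \<union> J) ?L)" using A' by simp
    also have "\<dots> = (\<integral>\<^sup>+x. (\<integral>\<^sup>+y. indicator A (merge I J (x, y)) \<partial>Pi\<^sub>M J ?L) \<partial>Pi\<^sub>M I ?L)"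
      using disj fin A' by (intro L.product_nn_integral_fold) auto
    also have "\<dots> = (\<integral>\<^sup>+x. (\<integral>\<^sup>+y. indicator A (merge I J (x, y)) * indicator (PiE J B) y \<partial>Pi\<^sub>M J ?L)
        * indicator (PiE I B) x \<partial>Pi\<^sub>M I ?L)"
    proof (rule nn_integral_cong)
      fix x assume x: "x \<in> space (Pi\<^sub>M I ?L)"
      have ind: "indicator A (merge I J (x, y)) =
          indicator A (merge I J (x, y)) * indicator (PiE J B) y * (indicator (PiE I B) x :: ennreal)"
        if y: "y \<in> space (Pi\<^sub>M J ?L)" for y
      proof (cases "merge I J (x, y) \<in> A")
        case True
        then have "merge I J (x, y) \<in> PiE (I \<union> J) B" using AS by auto
        then have "restrict (merge I J (x, y)) I \<in> PiE I B" "restrict (merge I J (x, y)) J \<in> PiE J B"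
          by (auto simp: PiE_iff)
        then have "x \<in> PiE I B" "y \<in> PiE J B"
          using x y disj by (auto simp: space_PiM PiE_restrict)
        then show ?thesis by simp
      qed simp
      then have "(\<integral>\<^sup>+y. indicator A (merge I J (x, y)) \<partial>Pi\<^sub>M J ?L) =
         (\<integral>\<^sup>+y. indicator A (merge I J (x, y)) * indicator (PiE J B) y * indicator (PiE I B) x \<partial>Pi\<^sub>M J ?L)"
        by (intro nn_integral_cong) auto
      also have "\<dots> = (\<integral>\<^sup>+y. indicator A (merge I J (x, y)) * indicator (PiE J B) y \<partial>Pi\<^sub>M J ?L) * indicator (PiE I B) x"
        by (cases "x \<in> PiE I B") auto
      finally show "(\<integral>\<^sup>+y. indicator A (merge I J (x, y)) \<partial>Pi\<^sub>M J ?L) = \<dots>" .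
    qed
    also have "\<dots> = (\<integral>\<^sup>+x. (\<integral>\<^sup>+y. indicator A (merge I J (x, y)) \<partial>leb_box J B) \<partial>leb_box I B)"
      using IB JB by (simp add: leb_box_def nn_integral_restrict_space)
    also have "\<dots> = (\<integral>\<^sup>+p. indicator A (merge I J p) \<partial>?P)"
      using measurable_compose[OF mm, of "indicator A" borel] A
      by (subst NJ.nn_integral_fst[symmetric]) auto
    also have "\<dots> = emeasure (distr ?P (leb_box (I \<union> J) B) (merge I J)) A"
      using A nn_integral_distr[OF mm, of "indicator A"] by simp
    finally show "emeasure (distr ?P (leb_box (I \<union> J) B) (merge I J)) A = emeasure (leb_box (I \<union> J) B) A"
      by simp
  qed simp
qed

text \<open>If \<open>N\<close> is \<open>N1 \<otimes> N2\<close> up to the map \<open>\<phi>\<close>, then a product of copies of \<open>N\<close> is the product of the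
  corresponding powers of \<open>N1\<close> and \<open>N2\<close>. The measures are compared on rectangles \<open>PiE A E\<close>: their
  preimages under \<open>\<Phi>\<close> are not rectangles, but the indicator is a product over \<open>i \<in> A\<close>, which can be
  integrated one factor at a time, first in \<open>z\<close> and then in \<open>x\<close>.\<close>

lemma distr_pair_PiM:
  assumes fin: "finite A"
    and sf: "sigma_finite_measure N1" "sigma_finite_measure N2" "sigma_finite_measure N"
    and [measurable]: "\<phi> \<in> measurable (N1 \<Otimes>\<^sub>M N2) N"
    and \<phi>: "distr (N1 \<Otimes>\<^sub>M N2) N \<phi> = N"
  defines "\<Phi> \<equiv> \<lambda>(x, z). \<lambda>i\<in>A. \<phi> (x i, z i)"
  shows "\<Phi> \<in> measurable (Pi\<^sub>M A (\<lambda>_. N1) \<Otimes>\<^sub>M Pi\<^sub>M A (\<lambda>_. N2)) (Pi\<^sub>M A (\<lambda>_. N))"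
    and "distr (Pi\<^sub>M A (\<lambda>_. N1) \<Otimes>\<^sub>M Pi\<^sub>M A (\<lambda>_. N2)) (Pi\<^sub>M A (\<lambda>_. N)) \<Phi> = Pi\<^sub>M A (\<lambda>_. N)"
proof -
  interpret N2: sigma_finite_measure N2 by fact
  interpret P1: product_sigma_finite "\<lambda>_. N1" using sf by (intro product_sigma_finite.intro)
  interpret P2: product_sigma_finite "\<lambda>_. N2" using sf by (intro product_sigma_finite.intro)
  interpret P: product_sigma_finite "\<lambda>_. N" using sf by (intro product_sigma_finite.intro)
  interpret T2: sigma_finite_measure "Pi\<^sub>M A (\<lambda>_. N2)" by (rule P2.sigma_finite[OF fin])
  let ?T = "Pi\<^sub>M A (\<lambda>_. N1) \<Otimes>\<^sub>M Pi\<^sub>M A (\<lambda>_. N2)"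
  show m: "\<Phi> \<in> measurable ?T (Pi\<^sub>M A (\<lambda>_. N))"
    unfolding \<Phi>_def by measurable
  show "distr ?T (Pi\<^sub>M A (\<lambda>_. N)) \<Phi> = Pi\<^sub>M A (\<lambda>_. N)"
  proof (rule P.PiM_eqI[OF fin])
    fix E assume E: "\<And>i. i \<in> A \<Longrightarrow> E i \<in> sets N"
    have PE: "PiE A E \<in> sets (Pi\<^sub>M A (\<lambda>_. N))" using fin E by (intro sets_PiM_I_finite)
    have fib: "(\<lambda>x. \<integral>\<^sup>+z. indicator (E i) (\<phi> (x, z)) \<partial>N2) \<in> borel_measurable N1" if "i \<in> A" for i
      using E[OF that] by measurable
    have "emeasure (distr ?T (Pi\<^sub>M A (\<lambda>_. N)) \<Phi>) (PiE A E) = (\<integral>\<^sup>+p. indicator (PiE A E) (\<Phi> p) \<partial>?T)"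
      using PE m nn_integral_distr[OF m, of "indicator (PiE A E)"] by simp
    also have "\<dots> = (\<integral>\<^sup>+x. (\<integral>\<^sup>+z. indicator (PiE A E) (\<Phi> (x, z)) \<partial>Pi\<^sub>M A (\<lambda>_. N2)) \<partial>Pi\<^sub>M A (\<lambda>_. N1))"
      using measurable_compose[OF m, of "indicator (PiE A E)" borel] PE
      by (subst T2.nn_integral_fst[symmetric]) auto
    also have "\<dots> = (\<integral>\<^sup>+x. (\<integral>\<^sup>+z. (\<Prod>i\<in>A. indicator (E i) (\<phi> (x i, z i))) \<partial>Pi\<^sub>M A (\<lambda>_. N2)) \<partial>Pi\<^sub>M A (\<lambda>_. N1))"
      using fin by (auto simp: \<Phi>_def PiE_iff indicator_def prod_zero_iff intro!: nn_integral_cong)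
    also have "\<dots> = (\<integral>\<^sup>+x. (\<Prod>i\<in>A. \<integral>\<^sup>+z. indicator (E i) (\<phi> (x i, z)) \<partial>N2) \<partial>Pi\<^sub>M A (\<lambda>_. N1))"
    proof (rule nn_integral_cong)
      fix x assume "x \<in> space (Pi\<^sub>M A (\<lambda>_. N1))"
      then have x: "x i \<in> space N1" if "i \<in> A" for i using that by (auto simp: space_PiM)
      show "(\<integral>\<^sup>+z. (\<Prod>i\<in>A. indicator (E i) (\<phi> (x i, z i))) \<partial>Pi\<^sub>M A (\<lambda>_. N2)) =
        (\<Prod>i\<in>A. \<integral>\<^sup>+z. indicator (E i) (\<phi> (x i, z)) \<partial>N2)"
      proof (rule P2.product_nn_integral_prod[OF fin])
        fix i assume i: "i \<in> A"
        note [measurable] = E[OF i]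
        show "(\<lambda>z. indicator (E i) (\<phi> (x i, z))) \<in> borel_measurable N2"
          using x[OF i] by measurable
      qed
    qed
    also have "\<dots> = (\<Prod>i\<in>A. \<integral>\<^sup>+x. \<integral>\<^sup>+z. indicator (E i) (\<phi> (x, z)) \<partial>N2 \<partial>N1)"
      using fin fib by (intro P1.product_nn_integral_prod[where f="\<lambda>i x. \<integral>\<^sup>+z. indicator (E i) (\<phi> (x, z)) \<partial>N2"])
    also have "\<dots> = (\<Prod>i\<in>A. emeasure N (E i))"
    proof (rule prod.cong)
      fix i assume i: "i \<in> A"
      note [measurable] = E[OF i]
      have "(\<integral>\<^sup>+x. \<integral>\<^sup>+z. indicator (E i) (\<phi> (x, z)) \<partial>N2 \<partial>N1) = (\<integral>\<^sup>+p. indicator (E i) (\<phi> p) \<partial>(N1 \<Otimes>\<^sub>M N2))"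
        by (intro N2.nn_integral_fst) measurable
      also have "\<dots> = (\<integral>\<^sup>+x. indicator (E i) x \<partial>distr (N1 \<Otimes>\<^sub>M N2) N \<phi>)"
        using E[OF i] by (subst nn_integral_distr) auto
      also have "\<dots> = emeasure N (E i)"
        using E[OF i] by (simp add: \<phi>)
      finally show "(\<integral>\<^sup>+x. \<integral>\<^sup>+z. indicator (E i) (\<phi> (x, z)) \<partial>N2 \<partial>N1) = emeasure N (E i)" .
    qed simp
    finally show "emeasure (distr ?T (Pi\<^sub>M A (\<lambda>_. N)) \<Phi>) (PiE A E) = (\<Prod>i\<in>A. emeasure N (E i))" .
  qed simp
qed

lemma injective_tuples_measurable:
  "{x \<in> space (leb_tuples J B k). inj_on x {..<k}} \<in> sets (leb_tuples J B k)"
proof -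
  have c: "(\<lambda>x. x i) \<in> borel_measurable (leb_tuples J B k)" if "i < k" for i
  proof (rule measurable_compose[OF _ leb_box_to_borel])
    show "(\<lambda>x. x i) \<in> measurable (leb_tuples J B k) (leb_box J B)"
      unfolding leb_tuples_def using that by (intro measurable_component_singleton) auto
  qed
  have "{x \<in> space (leb_tuples J B k). inj_on x {..<k}} =
     {x \<in> space (leb_tuples J B k). \<forall>i\<in>{..<k}. \<forall>j\<in>{..<k}. i \<noteq> j \<longrightarrow> x i \<noteq> x j}"
    unfolding inj_on_def by blast
  also have "\<dots> \<in> sets (leb_tuples J B k)"
    using c by (intro sets.sets_Collect borel_measurable_neq sets.sets_Collect_finite_All) auto
  finally show ?thesis .
qed

section \<open>Tuples of projected points\<close>

text \<open>A tuple \<open>x\<close> of distinct points of the image is the image of exactly \<open>\<Prod>i<k. count (image_mset r X) (x i)\<close>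
  tuples of points of \<open>X\<close>, because \<open>X\<close> is simple; these are the multiplicities with which \<open>x\<close> is
  counted on the left. Tuples whose images collide do not occur on the left, and are removed on the
  right by the condition on \<open>y\<close>. The identity holds for each configuration, so both sides
  have the same integral over configurations.\<close>

lemma distinct_sum_image_mset:
  assumes simple: "\<And>p. count X p \<le> 1"
  shows "distinct_sum (image_mset r X) k h =
    distinct_sum X k (\<lambda>y. if inj_on (\<lambda>i. r (y i)) {..<k} then h (\<lambda>i\<in>{..<k}. r (y i)) else 0)"
proof -
  define S where "S = set_mset X"
  define T where "T = {x \<in> {..<k} \<rightarrow>\<^sub>E r ` S. inj_on x {..<k}}"
  define U where "U = {y \<in> {..<k} \<rightarrow>\<^sub>E S. inj_on y {..<k}}"
  define V where "V = {y \<in> {..<k} \<rightarrow>\<^sub>E S. inj_on (\<lambda>i. r (y i)) {..<k}}"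
  define F where "F y = (\<lambda>i\<in>{..<k}. r (y i))" for y :: "nat \<Rightarrow> point"
  have one: "count X p = 1" if "p \<in> S" for p
    using simple[of p] that by (simp add: S_def le_antisym Suc_le_eq)
  have finS: "finite S" by (simp add: S_def)
  have finT: "finite T" and finU: "finite U" and finV: "finite V"
    unfolding T_def U_def V_def using finS by (auto intro!: finite_Collect_conjI disjI1 finite_PiE)
  have FV: "F ` V \<subseteq> T"
    by (auto simp: F_def V_def T_def PiE_iff extensional_def inj_on_def)
  have VU: "V \<subseteq> U"
    by (auto simp: U_def V_def inj_on_def)
  have fibre: "{y \<in> V. F y = x} = PiE {..<k} (\<lambda>i. {p \<in> S. r p = x i})" if "x \<in> T" for x
  proof (intro equalityI subsetI)
    fix y assume "y \<in> {y \<in> V. F y = x}"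
    then show "y \<in> PiE {..<k} (\<lambda>i. {p \<in> S. r p = x i})"
      by (auto simp: V_def F_def PiE_iff)
  next
    fix y assume y: "y \<in> PiE {..<k} (\<lambda>i. {p \<in> S. r p = x i})"
    then have eq: "r (y i) = x i" if "i < k" for i using that by auto
    then have "F y = x" using \<open>x \<in> T\<close> by (auto simp: F_def T_def PiE_iff extensional_def fun_eq_iff)
    moreover have "inj_on (\<lambda>i. r (y i)) {..<k}"
      using \<open>x \<in> T\<close> eq by (auto simp: T_def inj_on_def)
    ultimately show "y \<in> {y \<in> V. F y = x}" using y by (auto simp: V_def PiE_iff)
  qed
  have cnt: "count (image_mset r X) q = card {p \<in> S. r p = q}" for q
  proof -
    have "count (image_mset r X) q = sum (count X) (r -` {q} \<inter> set_mset X)"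
      by (simp add: count_image_mset)
    also have "\<dots> = card (r -` {q} \<inter> set_mset X)"
      using one by (subst sum.cong[OF refl, where h="\<lambda>_. 1"]) (auto simp: S_def)
    also have "r -` {q} \<inter> set_mset X = {p \<in> S. r p = q}" by (auto simp: S_def)
    finally show ?thesis .
  qed
  have mult: "(\<Prod>i<k. count (image_mset r X) (x i)) = card {y \<in> V. F y = x}" if "x \<in> T" for x
    unfolding fibre[OF that] by (simp add: cnt card_PiE)
  have "distinct_sum (image_mset r X) k h =
      (\<Sum>x\<in>T. of_nat (\<Prod>i<k. count (image_mset r X) (x i)) * ennreal (h x))"
    by (simp add: distinct_sum_def T_def S_def)
  also have "\<dots> = (\<Sum>x\<in>T. \<Sum>y\<in>{y \<in> V. F y = x}. ennreal (h (F y)))"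
    using mult by (intro sum.cong refl) simp
  also have "\<dots> = (\<Sum>y\<in>V. ennreal (h (F y)))"
    by (rule sum.group[OF finV finT FV])
  also have "\<dots> = (\<Sum>y\<in>U. ennreal (if inj_on (\<lambda>i. r (y i)) {..<k} then h (F y) else 0))"
    using VU finU by (intro sum.mono_neutral_cong_left) (auto simp: V_def U_def)
  also have "\<dots> = (\<Sum>y\<in>U. of_nat (\<Prod>i<k. count X (y i)) *
      ennreal (if inj_on (\<lambda>i. r (y i)) {..<k} then h (F y) else 0))"
  proof (intro sum.cong refl)
    fix y assume "y \<in> U"
    then have "(\<Prod>i<k. count X (y i)) = 1" using one by (auto simp: U_def PiE_iff)
    then show "ennreal (if inj_on (\<lambda>i. r (y i)) {..<k} then h (F y) else 0) =
      of_nat (\<Prod>i<k. count X (y i)) * ennreal (if inj_on (\<lambda>i. r (y i)) {..<k} then h (F y) else 0)"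
      by (simp only: of_nat_1 mult_1)
  qed
  also have "\<dots> = distinct_sum X k (\<lambda>y. if inj_on (\<lambda>i. r (y i)) {..<k} then h (\<lambda>i\<in>{..<k}. r (y i)) else 0)"
    unfolding distinct_sum_def U_def S_def F_def by (rule refl)
  finally show ?thesis .
qed

section \<open>Determinants weighted by cycle lengths\<close>

text \<open>The Leibniz expansion of the determinant of \<open>H (x i) (x j)\<close> in which a cycle of length \<open>n\<close> gets the
  additional weight \<open>\<tau> n\<close>. With weight \<open>1\<close> it is the determinant, hence an intensity of
  the process with kernel \<open>H\<close>; with \<open>\<tau> n\<close> the trace of an \<open>n\<close>-th iterate it is an intensity of the
  projected process. Both enter the pair correlation functions, so the small cases are computed for all
  \<open>\<tau>\<close>.\<close>

definition cycle_weighted_det ::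
    "('a \<Rightarrow> 'a \<Rightarrow> complex) \<Rightarrow> (nat \<Rightarrow> complex) \<Rightarrow> nat \<Rightarrow> (nat \<Rightarrow> 'a) \<Rightarrow> complex" where
  "cycle_weighted_det H \<tau> k x =
     (\<Sum>\<sigma> | \<sigma> permutes {..<k}. of_int (sign \<sigma>) * (\<Prod>i<k. H (x i) (x (\<sigma> i))) *
        (\<Prod>Q\<in>orbit \<sigma> ` {..<k}. \<tau> (card Q)))"

lemma det_eq_cycle_weighted_det:
  "Determinant.det (mat k k (\<lambda>(i, j). H (x i) (x j))) = cycle_weighted_det H (\<lambda>_. 1) k x"
proof -
  have "signof \<sigma> * (\<Prod>i = 0..<k. mat k k (\<lambda>(i, j). H (x i) (x j)) $$ (i, \<sigma> i)) =
      of_int (sign \<sigma>) * (\<Prod>i<k. H (x i) (x (\<sigma> i)))" if "\<sigma> permutes {..<k}" for \<sigma>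
    using permutes_in_image[OF that] by (auto simp: lessThan_atLeast0 intro!: prod.cong)
  then show ?thesis
    by (simp add: det_def'[of _ k] cycle_weighted_det_def lessThan_atLeast0)
qed

lemma cycle_weighted_det_eq_trace_form:
  "cycle_weighted_det H \<tau> k x =
     (\<Sum>\<sigma> | \<sigma> permutes {..<k}. (-1) ^ (k - num_cycles k \<sigma>) * (\<Prod>i<k. H (x i) (x (\<sigma> i))) *
        \<tau> 1 ^ (k - supp_size \<sigma>) * (\<Prod>\<epsilon>\<in>nontrivial_cycles \<sigma>. \<tau> (supp_size \<epsilon>)))"
  unfolding cycle_weighted_det_def
  by (intro sum.cong refl)
     (simp add: sign_eq_orbits[of "{..<k}"] num_cycles_def
        prod_orbits_nontrivial_cycles[of "{..<k}" _ \<tau>] mult.assoc)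

lemma cycle_weighted_det_1:
  "cycle_weighted_det H \<tau> 1 x = H (x 0) (x 0) * \<tau> 1"
proof -
  have "{\<sigma>. \<sigma> permutes {..<1::nat}} = {id}" by (auto simp: lessThan_Suc)
  moreover have "orbit id ` {..<1::nat} = (\<lambda>i. {i}) ` {..<1}" by (rule orbits_of_fixed) simp
  ultimately show ?thesis by (simp add: cycle_weighted_det_def lessThan_Suc)
qed

lemma cycle_weighted_det_2:
  "cycle_weighted_det H \<tau> 2 x =
     H (x 0) (x 0) * H (x 1) (x 1) * (\<tau> 1)\<^sup>2 - H (x 0) (x 1) * H (x 1) (x 0) * \<tau> 2"
proof -
  let ?t = "Transposition.transpose 0 (1::nat)"
  have two: "{..<2} = {0, 1::nat}" by auto
  have perms: "{\<sigma>. \<sigma> permutes {0, 1::nat}} = {id, ?t}"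
    by (auto simp only: permutes_doubleton_iff)
  have ne: "id \<noteq> ?t" by (metis id_apply transpose_apply_first zero_neq_one)
  have "orbit id ` {0, 1::nat} = (\<lambda>i. {i}) ` {0, 1}" by (rule orbits_of_fixed) simp
  then have id: "(\<Prod>Q\<in>orbit id ` {0, 1::nat}. \<tau> (card Q)) = (\<tau> 1)\<^sup>2"
    by (simp only: prod.reindex inj_singleton) (simp add: power2_eq_square)
  have p: "?t permutes {0, 1}" unfolding permutes_doubleton_iff by (rule disjI2[OF refl])
  have sub: "orbit ?t i \<subseteq> {0, 1}" if "i \<in> {0, 1}" for i
    by (rule permutes_orbit_subset[OF p that])
  have "?t i \<in> orbit ?t i" "?t (?t i) \<in> orbit ?t i" for i
    by (rule orbit.base, rule orbit.step[OF orbit.base])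
  from this[of 0] this[of 1] have "{0, 1} \<subseteq> orbit ?t 0" "{0, 1} \<subseteq> orbit ?t 1" by simp_all
  then have "orbit ?t 0 = {0, 1}" "orbit ?t 1 = {0, 1}" using sub by blast+
  then have "orbit ?t ` {0, 1} = {{0, 1}}" by auto
  then have t: "(\<Prod>Q\<in>orbit ?t ` {0, 1}. \<tau> (card Q)) = \<tau> 2" by (simp add: numeral_2_eq_2)
  show ?thesis
    unfolding cycle_weighted_det_def two perms
    using ne by (simp add: id[simplified] t[simplified] sign_swap_id)
qed

context bounded_kernel
begin

text \<open>In the Leibniz expansion of the determinant of a product kernel the factors with \<open>H\<close> are constants,
  and the factors with \<open>K\<close> are arranged along the cycles of \<open>\<sigma>\<close>, where \<open>integral_cycles\<close> applies.\<close>

lemma integral_det_eq_cycle_weighted_det: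
  shows "integrable (leb_tuples J B k)
      (\<lambda>z. Determinant.det (mat k k (\<lambda>(i, j). H (x i) (x j) * K (z i) (z j))))" (is ?int)
    and "(\<integral>z. Determinant.det (mat k k (\<lambda>(i, j). H (x i) (x j) * K (z i) (z j))) \<partial>leb_tuples J B k) =
      cycle_weighted_det H (\<lambda>m. kernel_trace J B (Kit m)) k x" (is ?eq)
proof -
  have det: "Determinant.det (mat k k (\<lambda>(i, j). H (x i) (x j) * K (z i) (z j))) =
     (\<Sum>\<sigma> | \<sigma> permutes {..<k}. of_int (sign \<sigma>) * (\<Prod>i<k. H (x i) (x (\<sigma> i))) *
        (\<Prod>i<k. K (z i) (z (\<sigma> i))))" for z
    using det_eq_cycle_weighted_det[of k "\<lambda>(x, z) (x', z'). H x x' * K z z'" "\<lambda>i. (x i, z i)"]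
    by (simp add: cycle_weighted_det_def prod.distrib mult.assoc)
  have int: "integrable (leb_tuples J B k) (\<lambda>z. \<Prod>i<k. K (z i) (z (\<sigma> i)))"
    if "\<sigma> permutes {..<k}" for \<sigma>
    using integrable_product[of "{..<k}" \<sigma> "\<lambda>_. 1"] permutes_in_image[OF that]
    by (auto simp: leb_tuples_def)
  have val: "(\<integral>z. (\<Prod>i<k. K (z i) (z (\<sigma> i))) \<partial>leb_tuples J B k) =
      (\<Prod>Q\<in>orbit \<sigma> ` {..<k}. kernel_trace J B (Kit (card Q)))" if "\<sigma> permutes {..<k}" for \<sigma>
    using integral_cycles[OF _ that, of "\<lambda>_. 1"] by (simp add: leb_tuples_def)
  show ?int
    unfolding det using int by (intro Bochner_Integration.integrable_sum integrable_mult_right) auto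
  show ?eq
    unfolding det cycle_weighted_det_def using int
    by (subst Bochner_Integration.integral_sum) (auto intro!: sum.cong simp: val)
qed

end

section \<open>Intensities and pair correlation of the projection\<close>

theorem theorem2p1:
  fixes d :: nat and I :: "nat set" and B :: "nat \<Rightarrow> real set"
    and M :: "'w measure" and X :: "'w \<Rightarrow> point multiset"
    and K KI KIc :: "point \<Rightarrow> point \<Rightarrow> complex"
  defines "Ic \<equiv> {1..d} - I"
  assumes "I \<subseteq> {1..d}"
    and "\<And>i. i \<in> {1..d} \<Longrightarrow> compact (B i)"
    and "DPP M {1..d} B X K"
    and "continuous_covariance (PiE I B) KI"
    and "continuous_covariance (PiE Ic B) KIc"
    and "\<And>x y. x \<in> PiE {1..d} B \<Longrightarrow> y \<in> PiE {1..d} B \<Longrightarrow>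
           K x y = KI (restrict x I) (restrict y I) * KIc (restrict x Ic) (restrict y Ic)"
  shows "\<exists>\<rho>.
    (\<forall>k\<ge>1. intensity_function M I B (project I X) k (\<rho> k) \<and>
       (\<forall>x \<in> {..<k} \<rightarrow>\<^sub>E PiE I B. inj_on x {..<k} \<longrightarrow>
          complex_of_real (\<rho> k x) =
            (\<Sum>\<sigma> | \<sigma> permutes {..<k}.
               (-1) ^ (k - num_cycles k \<sigma>) * (\<Prod>i<k. KI (x i) (x (\<sigma> i))) *
               kernel_trace Ic B KIc ^ (k - supp_size \<sigma>) *
               (\<Prod>\<epsilon>\<in>nontrivial_cycles \<sigma>.
                  kernel_trace Ic B (iterated_kernel Ic B KIc (supp_size \<epsilon>)))))) \<and>
    (\<forall>x \<in> PiE I B. complex_of_real (\<rho> 1 (tuple [x])) = KI x x * kernel_trace Ic B KIc) \<and>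
    (\<forall>(N :: 'v measure) Y \<rho>Y. DPP_with N I B Y KI \<rho>Y \<longrightarrow>
       (\<forall>x \<in> PiE I B. \<forall>y \<in> PiE I B.
          x \<noteq> y \<and> \<rho> 1 (tuple [x]) \<noteq> 0 \<and> \<rho> 1 (tuple [y]) \<noteq> 0 \<longrightarrow>
          complex_of_real (pair_correlation \<rho> x y) =
            1 - kernel_trace Ic B (iterated_kernel Ic B KIc 2) / (kernel_trace Ic B KIc)\<^sup>2 *
                (1 - complex_of_real (pair_correlation \<rho>Y x y))))"
proof -
  note I_sub = assms(2) and cpt = assms(3) and dpp = assms(4) and cov_Ic = assms(6) and K_eq = assms(7)
  have fin: "finite I" "finite Ic" and U: "I \<union> Ic = {1..d}" and disj: "I \<inter> Ic = {}"
    using I_sub by (auto simp: Ic_def intro: finite_subset)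
  have cptI: "compact (B i)" if "i \<in> I" for i using cpt that I_sub by auto
  have cptIc: "compact (B i)" if "i \<in> Ic" for i using cpt that by (auto simp: Ic_def)
  have cptU: "compact (B i)" if "i \<in> I \<union> Ic" for i using cpt that U by auto
  obtain C where "bounded_kernel Ic B KIc C"
    using bounded_kernel_continuous[OF fin(2) cptIc cov_Ic] by auto
  then interpret bounded_kernel Ic B KIc C .
  define \<tau> where "\<tau> m = kernel_trace Ic B (iterated_kernel Ic B KIc m)" for m
  obtain \<rho>X where \<rho>X: "DPP_with M {1..d} B X K \<rho>X" using dpp by (auto simp: DPP_def)
  define \<Phi> where "\<Phi> = (\<lambda>k (x, z). \<lambda>i\<in>{..<k::nat}. merge I Ic (x i, z i :: point))"
  \<comment> \<open>The version that vanishes at tuples with repeated points, as the convention for intensities demands.\<close>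
  define \<rho> where "\<rho> k x = (if inj_on x {..<k}
    then \<integral>z. \<rho>X k (\<Phi> k (x, z)) \<partial>leb_tuples Ic B k else 0)" for k x

  have sfI: "sigma_finite_measure (leb_box I B)" and sfIc: "sigma_finite_measure (leb_box Ic B)"
    and sfU: "sigma_finite_measure (leb_box {1..d} B)"
    using finite_measure_leb_box[OF fin(1) cptI] finite_measure_leb_box[OF fin(2) cptIc]
      finite_measure_leb_box[OF finite_atLeastAtMost cpt] by (auto simp: finite_measure_def)
  have merge_meas: "merge I Ic \<in> measurable (leb_box I B \<Otimes>\<^sub>M leb_box Ic B) (leb_box {1..d} B)"
    and merge_distr: "distr (leb_box I B \<Otimes>\<^sub>M leb_box Ic B) (leb_box {1..d} B) (merge I Ic) = leb_box {1..d} B"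
    using distr_merge_leb_box[OF fin disj cptU] unfolding U by auto
  have \<Phi>_meas: "\<Phi> k \<in> measurable (leb_tuples I B k \<Otimes>\<^sub>M leb_tuples Ic B k) (leb_tuples {1..d} B k)"
    and \<Phi>_distr: "distr (leb_tuples I B k \<Otimes>\<^sub>M leb_tuples Ic B k) (leb_tuples {1..d} B k) (\<Phi> k) =
      leb_tuples {1..d} B k" for k
    using distr_pair_PiM[OF finite_lessThan sfI sfIc sfU merge_meas merge_distr, of k]
    by (simp_all add: leb_tuples_def \<Phi>_def)
  have sfT: "sigma_finite_measure (leb_tuples Ic B k)" for k
    unfolding leb_tuples_def by (rule PN.sigma_finite) simp
  \<comment> \<open>From here on, a tuple of points of \<open>B\<close> is split into the tuple \<open>x\<close> of its coordinates in \<open>I\<close> and the tuple \<open>z\<close> of those in \<open>Ic\<close>.\<close>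
  have fubini: "(\<integral>\<^sup>+y. f y \<partial>leb_tuples {1..d} B k) =
      (\<integral>\<^sup>+x. \<integral>\<^sup>+z. f (\<Phi> k (x, z)) \<partial>leb_tuples Ic B k \<partial>leb_tuples I B k)"
    if [measurable]: "f \<in> borel_measurable (leb_tuples {1..d} B k)" for f k
  proof -
    interpret T: sigma_finite_measure "leb_tuples Ic B k" by (rule sfT)
    note [measurable] = \<Phi>_meas[of k]
    have "(\<integral>\<^sup>+y. f y \<partial>leb_tuples {1..d} B k) = (\<integral>\<^sup>+p. f (\<Phi> k p) \<partial>(leb_tuples I B k \<Otimes>\<^sub>M leb_tuples Ic B k))"
      by (rule nn_integral_distr[OF \<Phi>_meas[of k], unfolded \<Phi>_distr, OF that])
    also have "\<dots> = (\<integral>\<^sup>+x. \<integral>\<^sup>+z. f (\<Phi> k (x, z)) \<partial>leb_tuples Ic B k \<partial>leb_tuples I B k)"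
      by (rule T.nn_integral_fst[symmetric]) measurable
    finally show ?thesis .
  qed

  have restr: "restrict (merge I Ic (u, v)) I = u" "restrict (merge I Ic (u, v)) Ic = v"
    if "u \<in> PiE I B" "v \<in> PiE Ic B" for u v
    using that disj by (auto simp: PiE_restrict)
  have box: "merge I Ic (u, v) \<in> PiE {1..d} B" if "u \<in> PiE I B" "v \<in> PiE Ic B" for u v
    using that disj U[symmetric] by (auto simp: merge_def PiE_iff extensional_def)
  have \<Phi>_space: "\<Phi> k (x, z) \<in> space (leb_tuples {1..d} B k)"
    if "x \<in> space (leb_tuples I B k)" "z \<in> space (leb_tuples Ic B k)" for k x z
    using measurable_space[OF \<Phi>_meas, of "(x, z)"] that by (simp add: space_pair_measure)

  have \<rho>X_det: "complex_of_real (\<rho>X k (\<Phi> k (x, z))) =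
      Determinant.det (mat k k (\<lambda>(i, j). KI (x i) (x j) * KIc (z i) (z j)))"
    if k: "k \<ge> 1" and x: "x \<in> space (leb_tuples I B k)" and z: "z \<in> space (leb_tuples Ic B k)" for k x z
  proof -
    have "complex_of_real (\<rho>X k (\<Phi> k (x, z))) =
        Determinant.det (mat k k (\<lambda>(i, j). K (\<Phi> k (x, z) i) (\<Phi> k (x, z) j)))"
      using \<rho>X \<Phi>_space[OF x z] k by (auto simp: DPP_with_def space_leb_tuples)
    also have "mat k k (\<lambda>(i, j). K (\<Phi> k (x, z) i) (\<Phi> k (x, z) j)) =
        mat k k (\<lambda>(i, j). KI (x i) (x j) * KIc (z i) (z j))"
    proof (rule cong_mat)
      fix i j assume "i < k" "j < k"
      moreover from this have "x i \<in> PiE I B" "x j \<in> PiE I B" "z i \<in> PiE Ic B" "z j \<in> PiE Ic B"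
        using x z by (auto simp: space_leb_tuples)
      ultimately show "(case (i, j) of (i, j) \<Rightarrow> K (\<Phi> k (x, z) i) (\<Phi> k (x, z) j)) =
          (case (i, j) of (i, j) \<Rightarrow> KI (x i) (x j) * KIc (z i) (z j))"
        by (simp add: \<Phi>_def K_eq[OF box box] restr)
    qed simp_all
    finally show ?thesis .
  qed
  have \<rho>X_int: "integrable (leb_tuples Ic B k) (\<lambda>z. \<rho>X k (\<Phi> k (x, z)))"
    and \<rho>X_val: "complex_of_real (\<integral>z. \<rho>X k (\<Phi> k (x, z)) \<partial>leb_tuples Ic B k) = cycle_weighted_det KI \<tau> k x"
    if k: "k \<ge> 1" and x: "x \<in> space (leb_tuples I B k)" for k x
  proof -
    have "integrable (leb_tuples Ic B k) (\<lambda>z. complex_of_real (\<rho>X k (\<Phi> k (x, z))))"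
      using integral_det_eq_cycle_weighted_det(1)[of k KI x]
      by (subst Bochner_Integration.integrable_cong[OF refl \<rho>X_det[OF k x]])
    from integrable_Re[OF this] show "integrable (leb_tuples Ic B k) (\<lambda>z. \<rho>X k (\<Phi> k (x, z)))" by simp
    have "complex_of_real (\<integral>z. \<rho>X k (\<Phi> k (x, z)) \<partial>leb_tuples Ic B k) =
       (\<integral>z. complex_of_real (\<rho>X k (\<Phi> k (x, z))) \<partial>leb_tuples Ic B k)"
      by simp
    also have "\<dots> = (\<integral>z. Determinant.det (mat k k (\<lambda>(i, j). KI (x i) (x j) * KIc (z i) (z j))) \<partial>leb_tuples Ic B k)"
      by (rule Bochner_Integration.integral_cong[OF refl \<rho>X_det[OF k x]])
    also have "\<dots> = cycle_weighted_det KI \<tau> k x"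
      unfolding \<tau>_def by (rule integral_det_eq_cycle_weighted_det(2))
    finally show "complex_of_real (\<integral>z. \<rho>X k (\<Phi> k (x, z)) \<partial>leb_tuples Ic B k) = cycle_weighted_det KI \<tau> k x" .
  qed
  have \<rho>_val: "complex_of_real (\<rho> k x) = cycle_weighted_det KI \<tau> k x"
    if "k \<ge> 1" "x \<in> space (leb_tuples I B k)" "inj_on x {..<k}" for k x
    using that by (simp add: \<rho>_def \<rho>X_val)

  have intensity: "intensity_function M I B (project I X) k (\<rho> k)" if k: "k \<ge> 1" for k
    unfolding intensity_function_def
  proof (intro conjI ballI impI)
    have \<rho>Xk: "intensity_function M {1..d} B X k (\<rho>X k)" using \<rho>X k by (auto simp: DPP_with_def)
    then have [measurable]: "\<rho>X k \<in> borel_measurable (leb_tuples {1..d} B k)"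
      and \<rho>X_nonneg: "\<And>y. y \<in> space (leb_tuples {1..d} B k) \<Longrightarrow> 0 \<le> \<rho>X k y"
      by (auto simp: intensity_function_def)
    note [measurable] = \<Phi>_meas[of k]
    interpret T: sigma_finite_measure "leb_tuples Ic B k" by (rule sfT)
    have "(\<lambda>x. \<integral>z. \<rho>X k (\<Phi> k (x, z)) \<partial>leb_tuples Ic B k) \<in> borel_measurable (leb_tuples I B k)"
      by (intro T.borel_measurable_lebesgue_integral) measurable
    then show "\<rho> k \<in> borel_measurable (leb_tuples I B k)"
      unfolding \<rho>_def using injective_tuples_measurable[of I B k]
      by (intro measurable_If) auto
    show "0 \<le> \<rho> k x" if "x \<in> space (leb_tuples I B k)" for x
      using \<rho>X_nonneg \<Phi>_space[OF that] by (auto simp: \<rho>_def intro!: integral_nonneg_AE)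
    show "\<rho> k x = 0" if "\<not> inj_on x {..<k}" for x using that by (simp add: \<rho>_def)
    fix h :: "(nat \<Rightarrow> point) \<Rightarrow> real"
    assume [measurable]: "h \<in> borel_measurable (leb_tuples I B k)"
      and h: "\<forall>x\<in>space (leb_tuples I B k). 0 \<le> h x"
    \<comment> \<open>The test function \<open>h\<close> is pulled back along the projection \<open>R\<close> after cutting it off to \<open>g\<close> at colliding tuples.\<close>
    define R where "R y = (\<lambda>i\<in>{..<k}. restrict (y i) I)" for y :: "nat \<Rightarrow> point"
    define g where "g x = (if inj_on x {..<k} then h x else 0)" for x
    have R_meas [measurable]: "R \<in> measurable (leb_tuples {1..d} B k) (leb_tuples I B k)"
      unfolding R_def leb_tuples_def
    proof (rule measurable_restrict)
      fix i assume "i \<in> {..<k}"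
      then have "(\<lambda>y. y i) \<in> measurable (Pi\<^sub>M {..<k} (\<lambda>_. leb_box {1..d} B)) (leb_box {1..d} B)"
        by (rule measurable_component_singleton)
      from measurable_compose[OF this restrict_measurable_leb_box[OF I_sub]]
      show "(\<lambda>y. restrict (y i) I) \<in> measurable (Pi\<^sub>M {..<k} (\<lambda>_. leb_box {1..d} B)) (leb_box I B)" .
    qed
    have g_meas [measurable]: "g \<in> borel_measurable (leb_tuples I B k)"
      unfolding g_def using injective_tuples_measurable[of I B k] by (intro measurable_If) auto
    have g_nonneg: "0 \<le> g x" if "x \<in> space (leb_tuples I B k)" for x
      using h that by (auto simp: g_def)
    have gR: "(if inj_on (\<lambda>i. restrict (y i) I) {..<k} then h (\<lambda>i\<in>{..<k}. restrict (y i) I) else 0) = g (R y)" for y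
      unfolding g_def R_def by (simp add: inj_on_def)
    have "(\<integral>\<^sup>+\<omega>. distinct_sum (project I X \<omega>) k h \<partial>M) = (\<integral>\<^sup>+\<omega>. distinct_sum (X \<omega>) k (\<lambda>y. g (R y)) \<partial>M)"
    proof (rule nn_integral_cong)
      fix \<omega> assume "\<omega> \<in> space M"
      then have "count (X \<omega>) p \<le> 1" for p using \<rho>X by (auto simp: DPP_with_def simple_process_def)
      then show "distinct_sum (project I X \<omega>) k h = distinct_sum (X \<omega>) k (\<lambda>y. g (R y))"
        unfolding project_def gR[symmetric] by (rule distinct_sum_image_mset)
    qed
    also have "\<dots> = (\<integral>\<^sup>+y. ennreal (\<rho>X k y * g (R y)) \<partial>leb_tuples {1..d} B k)"
    proof -
      have "(\<lambda>y. g (R y)) \<in> borel_measurable (leb_tuples {1..d} B k)" by measurable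
      moreover have "\<forall>y\<in>space (leb_tuples {1..d} B k). 0 \<le> g (R y)"
        using g_nonneg measurable_space[OF R_meas] by auto
      ultimately show ?thesis
        using \<rho>Xk[unfolded intensity_function_def, THEN conjunct2, THEN conjunct2, THEN conjunct2]
        by (simp only:)
    qed
    also have "\<dots> = (\<integral>\<^sup>+x. \<integral>\<^sup>+z. ennreal (\<rho>X k (\<Phi> k (x, z)) * g (R (\<Phi> k (x, z))))
        \<partial>leb_tuples Ic B k \<partial>leb_tuples I B k)"
      by (rule fubini) measurable
    also have "\<dots> = (\<integral>\<^sup>+x. ennreal (\<rho> k x * h x) \<partial>leb_tuples I B k)"
    proof (rule nn_integral_cong)
      fix x assume x: "x \<in> space (leb_tuples I B k)"
      have R\<Phi>: "R (\<Phi> k (x, z)) = x" if "z \<in> space (leb_tuples Ic B k)" for z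
      proof
        fix i
        have "restrict (merge I Ic (x i, z i)) I = x i" if "i < k"
          using x \<open>z \<in> _\<close> that by (intro restr) (auto simp: space_leb_tuples)
        then show "R (\<Phi> k (x, z)) i = x i"
          using x by (auto simp: R_def \<Phi>_def space_leb_tuples PiE_iff extensional_def)
      qed
      have "(\<integral>\<^sup>+z. ennreal (\<rho>X k (\<Phi> k (x, z)) * g (R (\<Phi> k (x, z)))) \<partial>leb_tuples Ic B k) =
          (\<integral>\<^sup>+z. ennreal (\<rho>X k (\<Phi> k (x, z)) * g x) \<partial>leb_tuples Ic B k)"
        by (intro nn_integral_cong) (simp add: R\<Phi>)
      also have "\<dots> = ennreal (\<integral>z. \<rho>X k (\<Phi> k (x, z)) * g x \<partial>leb_tuples Ic B k)"
        using \<rho>X_int[OF k x] \<rho>X_nonneg \<Phi>_space[OF x] g_nonneg[OF x]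
        by (intro nn_integral_eq_integral) auto
      also have "\<dots> = ennreal (\<rho> k x * h x)" by (simp add: \<rho>_def g_def)
      finally show "(\<integral>\<^sup>+z. ennreal (\<rho>X k (\<Phi> k (x, z)) * g (R (\<Phi> k (x, z)))) \<partial>leb_tuples Ic B k) =
        ennreal (\<rho> k x * h x)" .
    qed
    finally show "(\<integral>\<^sup>+\<omega>. distinct_sum (project I X \<omega>) k h \<partial>M) =
      (\<integral>\<^sup>+x. ennreal (\<rho> k x * h x) \<partial>leb_tuples I B k)" .
  qed

  have tuple1: "tuple [x] \<in> space (leb_tuples I B 1)" "inj_on (tuple [x]) {..<1}" "tuple [x] 0 = x"
    if "x \<in> PiE I B" for x
    using that by (auto simp: tuple_def space_leb_tuples PiE_iff extensional_def lessThan_Suc)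
  have tuple2: "tuple [x, y] \<in> space (leb_tuples I B 2)" "tuple [x, y] 0 = x" "tuple [x, y] 1 = y"
    if "x \<in> PiE I B" "y \<in> PiE I B" for x y
    using that by (auto simp: tuple_def space_leb_tuples PiE_iff extensional_def less_2_cases_iff)
  have tuple2_inj: "inj_on (tuple [x, y]) {..<2}" if "x \<noteq> y" for x y :: point
    using that by (auto simp: tuple_def inj_on_def less_2_cases_iff)
  have \<rho>1: "complex_of_real (\<rho> 1 (tuple [x])) = KI x x * \<tau> 1" if "x \<in> PiE I B" for x
    using \<rho>_val[OF order.refl tuple1(1,2)[OF that]] tuple1(3)[OF that]
    by (simp only: cycle_weighted_det_1)
  have \<rho>2: "complex_of_real (\<rho> 2 (tuple [x, y])) = KI x x * KI y y * (\<tau> 1)\<^sup>2 - KI x y * KI y x * \<tau> 2"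
    if "x \<in> PiE I B" "y \<in> PiE I B" "x \<noteq> y" for x y
    using \<rho>_val[OF _ tuple2(1)[OF that(1,2)] tuple2_inj[OF that(3)]] tuple2(2,3)[OF that(1,2)]
    by (simp only: cycle_weighted_det_2 one_le_numeral)
  have \<tau>1: "\<tau> 1 = kernel_trace Ic B KIc" by (simp add: \<tau>_def)

  have pair: "complex_of_real (pair_correlation \<rho> x y) =
      1 - \<tau> 2 / (\<tau> 1)\<^sup>2 * (1 - complex_of_real (pair_correlation \<rho>Y x y))"
    if Y: "DPP_with N I B Y KI \<rho>Y" and xy: "x \<in> PiE I B" "y \<in> PiE I B" "x \<noteq> y"
      and nz: "\<rho> 1 (tuple [x]) \<noteq> 0" "\<rho> 1 (tuple [y]) \<noteq> 0"
    for N :: "'v measure" and Y \<rho>Y x y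
  proof -
    have Ydet: "complex_of_real (\<rho>Y k u) = cycle_weighted_det KI (\<lambda>_. 1) k u"
      if "k \<ge> 1" "u \<in> space (leb_tuples I B k)" for k u
      using Y that unfolding DPP_with_def space_leb_tuples
      by (simp add: det_eq_cycle_weighted_det)
    have Y1: "complex_of_real (\<rho>Y 1 (tuple [u])) = KI u u" if "u \<in> PiE I B" for u
      using Ydet[OF order.refl tuple1(1)[OF that]] tuple1(3)[OF that]
      by (simp only: cycle_weighted_det_1 mult_1_right)
    have Y2: "complex_of_real (\<rho>Y 2 (tuple [x, y])) = KI x x * KI y y - KI x y * KI y x"
      using Ydet[OF _ tuple2(1)[OF xy(1,2)]] tuple2(2,3)[OF xy(1,2)]
      by (simp only: cycle_weighted_det_2 one_le_numeral mult_1_right power_one)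
    have "complex_of_real (\<rho> 1 (tuple [x])) \<noteq> 0" "complex_of_real (\<rho> 1 (tuple [y])) \<noteq> 0"
      using nz by (simp_all only: of_real_eq_0_iff not_False_eq_True)
    then have KI0: "KI x x \<noteq> 0" "KI y y \<noteq> 0" "\<tau> 1 \<noteq> 0"
      unfolding \<rho>1[OF xy(1)] \<rho>1[OF xy(2)] by auto
    then have "\<rho>Y 1 (tuple [x]) \<noteq> 0" "\<rho>Y 1 (tuple [y]) \<noteq> 0"
      using Y1[OF xy(1)] Y1[OF xy(2)] by auto
    then have gY: "complex_of_real (pair_correlation \<rho>Y x y) =
        (KI x x * KI y y - KI x y * KI y x) / (KI x x * KI y y)"
      by (simp add: pair_correlation_def Y1[OF xy(1), simplified] Y1[OF xy(2), simplified] Y2)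
    have g: "complex_of_real (pair_correlation \<rho> x y) =
        (KI x x * KI y y * (\<tau> 1)\<^sup>2 - KI x y * KI y x * \<tau> 2) / (KI x x * \<tau> 1 * (KI y y * \<tau> 1))"
      unfolding pair_correlation_def using nz
      by (simp only: if_False simp_thms of_real_divide of_real_mult \<rho>1[OF xy(1)] \<rho>1[OF xy(2)] \<rho>2[OF xy])
    show ?thesis
      unfolding g gY using KI0 by (simp add: field_simps power2_eq_square)
  qed
  show ?thesis
  proof (intro exI[of _ \<rho>] conjI allI ballI impI)
    show "intensity_function M I B (project I X) k (\<rho> k)" if "1 \<le> k" for k
      using that by (rule intensity)
    show "complex_of_real (\<rho> k x) =
        (\<Sum>\<sigma> | \<sigma> permutes {..<k}.
           (-1) ^ (k - num_cycles k \<sigma>) * (\<Prod>i<k. KI (x i) (x (\<sigma> i))) *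
           kernel_trace Ic B KIc ^ (k - supp_size \<sigma>) *
           (\<Prod>\<epsilon>\<in>nontrivial_cycles \<sigma>.
              kernel_trace Ic B (iterated_kernel Ic B KIc (supp_size \<epsilon>))))"
      if "1 \<le> k" "x \<in> {..<k} \<rightarrow>\<^sub>E PiE I B" "inj_on x {..<k}" for k x
      using \<rho>_val[OF that(1) _ that(3)] that(2)
      unfolding cycle_weighted_det_eq_trace_form space_leb_tuples \<tau>1 unfolding \<tau>_def by blast
    show "complex_of_real (\<rho> 1 (tuple [x])) = KI x x * kernel_trace Ic B KIc" if "x \<in> PiE I B" for x
      using \<rho>1[OF that] unfolding \<tau>1 .
    show "complex_of_real (pair_correlation \<rho> x y) =
        1 - kernel_trace Ic B (iterated_kernel Ic B KIc 2) / (kernel_trace Ic B KIc)\<^sup>2 *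
          (1 - complex_of_real (pair_correlation \<rho>Y x y))"
      if "DPP_with N I B Y KI \<rho>Y" "x \<in> PiE I B" "y \<in> PiE I B"
        "x \<noteq> y \<and> \<rho> 1 (tuple [x]) \<noteq> 0 \<and> \<rho> 1 (tuple [y]) \<noteq> 0"
      for N :: "'v measure" and Y \<rho>Y x y
      using pair[OF that(1-3)] that(4) unfolding \<tau>1 unfolding \<tau>_def by blast
  qed
qed

end
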